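(* Let $G$ be a group, $X$ a nonempty topological space, and $\mathcal{M}$ an exact presheaf of $G$-structures on $X$. Then $\mathcal{M}$ has a generic $G$-model $\mathcal{M}^{gen}$; that is, there exists a filter $\mathbb{F}$ of open subsets of $X$ which is generic with respect to $\mathcal{M}$, and the colimit $\mathcal{M}^{gen}=\operatorname{colim}_{U\in\mathbb{F}}\mathcal{M}_U$ is a $G$-structure.
   Context: $G$-structures. Fix a first-order language $\mathcal{L}=(\mathcal{F},\mathcal{R},\mathcal{C})$ with equality. A $G$-structure is an $\mathcal{L}$-structure $\mathcal{M}$ with an action of $G$ on its universe $M$ such that: $G\,\mathcal{C}^{\mathcal{M}}=\mathcal{C}^{\mathcal{M}}$ for the set of interpreted constants; for each relation symbol $R$ of arity $n_R$, $(x_1,\dots,x_{n_R})\in R^{\mathcal{M}}$ and $g_1,\dots,g_{n_R}\in G$ imply $(g_1x_1,\dots,g_{n_R}x_{n_R})\in R^{\mathcal{M}}$; and $f^{\mathcal{M}}(gx_1,\dots,gx_n)=g f^{\mathcal{M}}(x_1,\dots,x_n)$ for each $n$-ary function symbol $f$ and $g\in G$. A morphism of $G$-structures is a $G$-equivariant map of universes commuting with the interpretations of function and constant symbols and sending $R^{\mathcal{M}}$ into $R^{\mathcal{N}}$ for each relation symbol $R$. Presheaves. A presheaf of $G$-structures on $X$ assigns to each open $U\subset X$ a $G$-structure $\mathcal{M}_U$ (with universe $M_U$) and to each inclusion $U\subset V$ of open sets a morphism of $G$-structures (restriction) $\rho_{UV}:\mathcal{M}_V\to\mathcal{M}_U$,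 also written $a\mapsto a|_U$, functorially. It is exact if for every family of open sets $(U_i)_i$ and sections $a_i\in M_{U_i}$ with $a_i|_{U_i\cap U_j}=a_j|_{U_i\cap U_j}$ for all $i,j$ there is a (not necessarily unique) $a\in M_{\bigcup_i U_i}$ with $a|_{U_i}=a_i$ for all $i$. Pointwise forcing. For a point $x$, an open $U\ni x$, a formula $\varphi(v)$ in free variables $v=(v_1,\dots,v_n)$ and $a\in M_U^n$, the relation $\mathcal{M}\Vdash_x\varphi(a)$ is defined by induction on $\varphi$. (On an open $V\subset U$, $a$ is understood as restricted to $V$ whenever needed.) - If $\varphi$ is built from atomic formulas using only $\wedge,\vee,\exists$ (no $\neg,\forall$): $\mathcal{M}\Vdash_x\varphi(a)$ iff $\mathcal{M}_V\models\varphi(a|_V)$ for some open $V$ with $x\in V\subset U$. - $\mathcal{M}\Vdash_x(\psi\wedge\theta)(a)$ iff $\mathcal{M}\Vdash_x\psi(a)$ and $\mathcal{M}\Vdash_x\theta(a)$; $\mathcal{M}\Vdash_x(\psi\vee\theta)(a)$ iff $\mathcal{M}\Vdash_x\psi(a)$ or $\mathcal{M}\Vdash_x\theta(a)$. - $\mathcal{M}\Vdash_x\exists w\,\psi(a,w)$ iff there are an open $V$ with $x\in V\subset U$ and $b\in M_V$ such that $\mathcal{M}\Vdash_x\psi(a|_V,b)$. - $\mathcal{M}\Vdash_x\neg\psi(a)$ iff there is an open $V$ with $x\in V\subset U$ such that $\mathcal{M}\not\Vdash_y\psi(a)$ for all $y\in V$. - $\mathcal{M}\Vdash_x(\psi\to\theta)(a)$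 iff there is an open $V$ with $x\in V\subset U$ such that for all $y\in V$, $\mathcal{M}\Vdash_y\psi(a)$ implies $\mathcal{M}\Vdash_y\theta(a)$. - $\mathcal{M}\Vdash_x\forall w\,\psi(a,w)$ iff there is an open $V$ with $x\in V\subset U$ such that for each $y\in V$ and each $b\in M_V$, $\mathcal{M}\Vdash_y\psi(a|_V,b)$. Open forcing. For $U$ open and $a\in M_U^n$, $\mathcal{M}\Vdash_U\varphi(a)$ iff $\mathcal{M}\Vdash_x\varphi(a)$ for all $x\in U$. Filters. A filter of open subsets of $X$ is a nonempty family $\mathbb{F}$ of nonempty open sets closed under finite intersections and under passing to larger open sets. It is generic with respect to $\mathcal{M}$ iff: (1) for each formula $\varphi(v)$ in free variables $v=(v_1,\dots,v_n)$, each $U\in\mathbb{F}$ and each $a\in M_U^n$ there is $V\in\mathbb{F}$, $V\subset U$, such that $\mathcal{M}\Vdash_V\varphi(a|_V)$ or $\mathcal{M}\Vdash_V\neg\varphi(a|_V)$; (2) for each formula $\varphi(v,w)$ in free variables $v=(v_1,\dots,v_n)$, $w=(w_1,\dots,w_m)$, each $U\in\mathbb{F}$ and each $a\in M_U^n$, if $\mathcal{M}\Vdash_U\exists w\,\varphi(a,w)$ then there are $V\in\mathbb{F}$, $V\subset U$, and $b\in M_V^m$ such that $\mathcal{M}\Vdash_V\varphi(a|_V,b)$. Generic models. A generic model of $\mathcal{M}$ is the colimit structure $\mathcal{M}^{gen}=\operatorname{colim}_{U\in\mathbb{F}}\mathcal{M}_U$ over a generic filter $\mathbb{F}$: its elements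 are germs $[a]$ of sections $a\in M_U$, $U\in\mathbb{F}$, where $a\in M_U$ and $b\in M_V$ have the same germ iff $a|_W=b|_W$ for some $W\in\mathbb{F}$, $W\subset U\cap V$; functions and constants are induced by representatives; a tuple of germs is in the interpretation of $R$ iff it has representatives in some common $M_W$, $W\in\mathbb{F}$, forming a tuple in $R^{\mathcal{M}_W}$; the action is $g[a]=[ga]$. When it is a $G$-structure it is called a generic $G$-model.
   Formalization: The formal version assumes exactly one section over the empty set, and in the forcing clause for ∀ lets b range over sections on every open W with y∈W⊂V, not only b∈M_V; taken literally the claim fails (counterexamples on Cantor space and on the circle). *)

theory Defs
  imports "HOL-Algebra.Group_Action" "HOL-Analysis.Abstract_Topology"
begin

section \<open>First-order languages, terms and formulas\<close>

record ('f, 'r, 'c) lang =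
  fun_syms :: "'f set"
  rel_syms :: "'r set"
  const_syms :: "'c set"
  fun_arity :: "'f \<Rightarrow> nat"
  rel_arity :: "'r \<Rightarrow> nat"

text \<open>
  Variables are de Bruijn levels: in a context of \<open>n\<close> free variables these are
  \<open>Var 0, \<dots>, Var (n - 1)\<close>, and a quantifier binds \<open>Var n\<close>. A tuple of values is a
  list of length \<open>n\<close>, and a quantifier appends the new value at the end of that list. Thus
  for \<open>\<phi>\<close> in context \<open>n + m\<close> the formula \<open>\<exists>w\<^sub>1 \<dots> \<exists>w\<^sub>m \<phi>(v, w)\<close> is \<open>(Exists ^^ m) \<phi>\<close>,
  and the values of \<open>(v, w)\<close> are \<open>a @ b\<close>.
\<close>

datatype ('f, 'c) tm =
    Var nat
  | Cst 'c
  | App 'f "('f, 'c) tm list"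

datatype ('f, 'r, 'c) fm =
    Eq "('f, 'c) tm" "('f, 'c) tm"
  | Rel 'r "('f, 'c) tm list"
  | Conj "('f, 'r, 'c) fm" "('f, 'r, 'c) fm"
  | Disj "('f, 'r, 'c) fm" "('f, 'r, 'c) fm"
  | Neg "('f, 'r, 'c) fm"
  | Imp "('f, 'r, 'c) fm" "('f, 'r, 'c) fm"
  | Exists "('f, 'r, 'c) fm"
  | Forall "('f, 'r, 'c) fm"

fun wf_tm :: "('f, 'r, 'c) lang \<Rightarrow> nat \<Rightarrow> ('f, 'c) tm \<Rightarrow> bool" where
  "wf_tm L n (Var i) \<longleftrightarrow> i < n"
| "wf_tm L n (Cst c) \<longleftrightarrow> c \<in> const_syms L"
| "wf_tm L n (App f ts) \<longleftrightarrow>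
     f \<in> fun_syms L \<and> length ts = fun_arity L f \<and> (\<forall>t\<in>set ts. wf_tm L n t)"

fun wf_fm :: "('f, 'r, 'c) lang \<Rightarrow> nat \<Rightarrow> ('f, 'r, 'c) fm \<Rightarrow> bool" where
  "wf_fm L n (Eq s t) \<longleftrightarrow> wf_tm L n s \<and> wf_tm L n t"
| "wf_fm L n (Rel R ts) \<longleftrightarrow>
     R \<in> rel_syms L \<and> length ts = rel_arity L R \<and> (\<forall>t\<in>set ts. wf_tm L n t)"
| "wf_fm L n (Conj \<phi> \<psi>) \<longleftrightarrow> wf_fm L n \<phi> \<and> wf_fm L n \<psi>"
| "wf_fm L n (Disj \<phi> \<psi>) \<longleftrightarrow> wf_fm L n \<phi> \<and> wf_fm L n \<psi>"
| "wf_fm L n (Neg \<phi>) \<longleftrightarrow> wf_fm L n \<phi>"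
| "wf_fm L n (Imp \<phi> \<psi>) \<longleftrightarrow> wf_fm L n \<phi> \<and> wf_fm L n \<psi>"
| "wf_fm L n (Exists \<phi>) \<longleftrightarrow> wf_fm L (Suc n) \<phi>"
| "wf_fm L n (Forall \<phi>) \<longleftrightarrow> wf_fm L (Suc n) \<phi>"


section \<open>G-structures\<close>

text \<open>The universe of a structure is its \<^const>\<open>carrier\<close>; it is allowed to be empty.\<close>

record ('f, 'r, 'c, 's) lstruct = "'s partial_object" +
  fun_int :: "'f \<Rightarrow> 's list \<Rightarrow> 's"
  rel_int :: "'r \<Rightarrow> 's list set"
  const_int :: "'c \<Rightarrow> 's"

record ('g, 'f, 'r, 'c, 's) gstruct = "('f, 'r, 'c, 's) lstruct" +
  act :: "'g \<Rightarrow> 's \<Rightarrow> 's"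

definition tuples :: "('s, 'z) partial_object_scheme \<Rightarrow> nat \<Rightarrow> 's list set" where
  "tuples M n = {a. length a = n \<and> set a \<subseteq> carrier M}"

definition is_lstruct ::
    "('f, 'r, 'c) lang \<Rightarrow> ('f, 'r, 'c, 's, 'z) lstruct_scheme \<Rightarrow> bool" where
  "is_lstruct L M \<longleftrightarrow>
     (\<forall>f\<in>fun_syms L. \<forall>xs\<in>tuples M (fun_arity L f). fun_int M f xs \<in> carrier M) \<and>
     (\<forall>R\<in>rel_syms L. rel_int M R \<subseteq> tuples M (rel_arity L R)) \<and>
     (\<forall>c\<in>const_syms L. const_int M c \<in> carrier M)"

definition is_gstruct ::
    "('g, 'k) monoid_scheme \<Rightarrow> ('f, 'r, 'c) lang \<Rightarrow> ('g, 'f, 'r, 'c, 's) gstruct \<Rightarrow> bool" where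
  "is_gstruct G L M \<longleftrightarrow>
     is_lstruct L M \<and>
     group_action G (carrier M) (act M) \<and>
     (\<Union>g\<in>carrier G. act M g ` (const_int M ` const_syms L)) = const_int M ` const_syms L \<and>
     (\<forall>R\<in>rel_syms L. \<forall>xs\<in>rel_int M R. \<forall>gs. length gs = rel_arity L R \<and> set gs \<subseteq> carrier G \<longrightarrow>
        map2 (act M) gs xs \<in> rel_int M R) \<and>
     (\<forall>f\<in>fun_syms L. \<forall>xs\<in>tuples M (fun_arity L f). \<forall>g\<in>carrier G.
        fun_int M f (map (act M g) xs) = act M g (fun_int M f xs))"

definition gstruct_morphism ::
    "('g, 'k) monoid_scheme \<Rightarrow> ('f, 'r, 'c) lang \<Rightarrow> ('g, 'f, 'r, 'c, 's) gstruct \<Rightarrow>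
     ('g, 'f, 'r, 'c, 't) gstruct \<Rightarrow> ('s \<Rightarrow> 't) \<Rightarrow> bool" where
  "gstruct_morphism G L M N h \<longleftrightarrow>
     (\<forall>x\<in>carrier M. h x \<in> carrier N) \<and>
     (\<forall>g\<in>carrier G. \<forall>x\<in>carrier M. h (act M g x) = act N g (h x)) \<and>
     (\<forall>f\<in>fun_syms L. \<forall>xs\<in>tuples M (fun_arity L f).
        h (fun_int M f xs) = fun_int N f (map h xs)) \<and>
     (\<forall>c\<in>const_syms L. h (const_int M c) = const_int N c) \<and>
     (\<forall>R\<in>rel_syms L. \<forall>xs\<in>rel_int M R. map h xs \<in> rel_int N R)"


section \<open>Presheaves of G-structures\<close>

text \<open>\<open>res P U V\<close> is the restriction map from the sections over \<open>V\<close> to those over \<open>U \<subseteq> V\<close>.\<close>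

record ('x, 'g, 'f, 'r, 'c, 's) presheaf =
  sec :: "'x set \<Rightarrow> ('g, 'f, 'r, 'c, 's) gstruct"
  res :: "'x set \<Rightarrow> 'x set \<Rightarrow> 's \<Rightarrow> 's"

text \<open>
  Presheaves are normalised in the usual way: there is exactly one section over the empty set.
  So in \<open>exact_presheaf\<close> below there is no compatibility condition on disjoint open sets.
\<close>

definition gstruct_presheaf ::
    "('g, 'k) monoid_scheme \<Rightarrow> ('f, 'r, 'c) lang \<Rightarrow> 'x topology \<Rightarrow>
     ('x, 'g, 'f, 'r, 'c, 's) presheaf \<Rightarrow> bool" where
  "gstruct_presheaf G L X P \<longleftrightarrow>
     (\<forall>U. openin X U \<longrightarrow> is_gstruct G L (sec P U)) \<and>
     (\<forall>U V. openin X U \<and> openin X V \<and> U \<subseteq> V \<longrightarrow>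
        gstruct_morphism G L (sec P V) (sec P U) (res P U V)) \<and>
     (\<forall>U. openin X U \<longrightarrow> (\<forall>a\<in>carrier (sec P U). res P U U a = a)) \<and>
     (\<forall>U V W. openin X U \<and> openin X V \<and> openin X W \<and> U \<subseteq> V \<and> V \<subseteq> W \<longrightarrow>
        (\<forall>a\<in>carrier (sec P W). res P U V (res P V W a) = res P U W a)) \<and>
     (\<exists>e. carrier (sec P {}) = {e})"

text \<open>
  A compatible family may be indexed by its set of open sets: \<open>U\<^sub>i = U\<^sub>j\<close> forces \<open>a\<^sub>i = a\<^sub>j\<close>.
\<close>

definition exact_presheaf ::
    "'x topology \<Rightarrow> ('x, 'g, 'f, 'r, 'c, 's) presheaf \<Rightarrow> bool" where
  "exact_presheaf X P \<longleftrightarrow>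
     (\<forall>\<U> a. (\<forall>U\<in>\<U>. openin X U \<and> a U \<in> carrier (sec P U)) \<and>
            (\<forall>U\<in>\<U>. \<forall>V\<in>\<U>. res P (U \<inter> V) U (a U) = res P (U \<inter> V) V (a V)) \<longrightarrow>
        (\<exists>s\<in>carrier (sec P (\<Union>\<U>)). \<forall>U\<in>\<U>. res P U (\<Union>\<U>) s = a U))"


section \<open>Satisfaction and forcing\<close>

primrec tm_val :: "('f, 'r, 'c, 's, 'z) lstruct_scheme \<Rightarrow> 's list \<Rightarrow> ('f, 'c) tm \<Rightarrow> 's" where
  "tm_val M a (Var i) = a ! i"
| "tm_val M a (Cst c) = const_int M c"
| "tm_val M a (App f ts) = fun_int M f (map (tm_val M a) ts)"

primrec sat :: "('f, 'r, 'c, 's, 'z) lstruct_scheme \<Rightarrow> ('f, 'r, 'c) fm \<Rightarrow> 's list \<Rightarrow> bool" where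
  "sat M (Eq s t) a \<longleftrightarrow> tm_val M a s = tm_val M a t"
| "sat M (Rel R ts) a \<longleftrightarrow> map (tm_val M a) ts \<in> rel_int M R"
| "sat M (Conj \<phi> \<psi>) a \<longleftrightarrow> sat M \<phi> a \<and> sat M \<psi> a"
| "sat M (Disj \<phi> \<psi>) a \<longleftrightarrow> sat M \<phi> a \<or> sat M \<psi> a"
| "sat M (Neg \<phi>) a \<longleftrightarrow> \<not> sat M \<phi> a"
| "sat M (Imp \<phi> \<psi>) a \<longleftrightarrow> (sat M \<phi> a \<longrightarrow> sat M \<psi> a)"
| "sat M (Exists \<phi>) a \<longleftrightarrow> (\<exists>b\<in>carrier M. sat M \<phi> (a @ [b]))"
| "sat M (Forall \<phi>) a \<longleftrightarrow> (\<forall>b\<in>carrier M. sat M \<phi> (a @ [b]))"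

definition open_nbhd :: "'x topology \<Rightarrow> 'x \<Rightarrow> 'x set \<Rightarrow> 'x set \<Rightarrow> bool" where
  "open_nbhd X x U V \<longleftrightarrow> openin X V \<and> x \<in> V \<and> V \<subseteq> U"

abbreviation restr ::
    "('x, 'g, 'f, 'r, 'c, 's) presheaf \<Rightarrow> 'x set \<Rightarrow> 'x set \<Rightarrow> 's list \<Rightarrow> 's list" where
  "restr P V U a \<equiv> map (res P V U) a"

text \<open>
  \<open>force X P \<phi> x U a\<close>: the formula \<open>\<phi>\<close> is forced at the point \<open>x\<close> for the tuple \<open>a\<close> of sections
  over \<open>U\<close>. The clause ``satisfied in some neighbourhood'' is used for atomic formulas only;
  that it holds for all formulas built with conjunction, disjunction and existential
  quantification is lemma \<open>force_positive\<close> below.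

  In the clause for \<open>Forall\<close> the section \<open>b\<close> may be defined on any open \<open>W \<subseteq> V\<close> containing \<open>y\<close>.
  Sections over \<open>V\<close> alone would not do: a section over \<open>W\<close> need not extend to \<open>V\<close>, and forcing
  at a point would then change when \<open>a\<close> is restricted to a smaller neighbourhood of that point.
\<close>

primrec force ::
    "'x topology \<Rightarrow> ('x, 'g, 'f, 'r, 'c, 's) presheaf \<Rightarrow> ('f, 'r, 'c) fm \<Rightarrow>
     'x \<Rightarrow> 'x set \<Rightarrow> 's list \<Rightarrow> bool" where
  "force X P (Eq s t) x U a \<longleftrightarrow>
     (\<exists>V. open_nbhd X x U V \<and> sat (sec P V) (Eq s t) (restr P V U a))"
| "force X P (Rel R ts) x U a \<longleftrightarrow>
     (\<exists>V. open_nbhd X x U V \<and> sat (sec P V) (Rel R ts) (restr P V U a))"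
| "force X P (Conj \<phi> \<psi>) x U a \<longleftrightarrow> force X P \<phi> x U a \<and> force X P \<psi> x U a"
| "force X P (Disj \<phi> \<psi>) x U a \<longleftrightarrow> force X P \<phi> x U a \<or> force X P \<psi> x U a"
| "force X P (Exists \<phi>) x U a \<longleftrightarrow>
     (\<exists>V. open_nbhd X x U V \<and> (\<exists>b\<in>carrier (sec P V). force X P \<phi> x V (restr P V U a @ [b])))"
| "force X P (Neg \<phi>) x U a \<longleftrightarrow>
     (\<exists>V. open_nbhd X x U V \<and> (\<forall>y\<in>V. \<not> force X P \<phi> y U a))"
| "force X P (Imp \<phi> \<psi>) x U a \<longleftrightarrow>
     (\<exists>V. open_nbhd X x U V \<and> (\<forall>y\<in>V. force X P \<phi> y U a \<longrightarrow> force X P \<psi> y U a))"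
| "force X P (Forall \<phi>) x U a \<longleftrightarrow>
     (\<exists>V. open_nbhd X x U V \<and>
        (\<forall>y\<in>V. \<forall>W. open_nbhd X y V W \<longrightarrow>
           (\<forall>b\<in>carrier (sec P W). force X P \<phi> y W (restr P W U a @ [b]))))"

definition force_open ::
    "'x topology \<Rightarrow> ('x, 'g, 'f, 'r, 'c, 's) presheaf \<Rightarrow> ('f, 'r, 'c) fm \<Rightarrow>
     'x set \<Rightarrow> 's list \<Rightarrow> bool" where
  "force_open X P \<phi> U a \<longleftrightarrow> (\<forall>x\<in>U. force X P \<phi> x U a)"


subsection \<open>Forcing of formulas without negation, implication and universal quantifier\<close>

fun positive :: "('f, 'r, 'c) fm \<Rightarrow> bool" where
  "positive (Eq s t) \<longleftrightarrow> True"
| "positive (Rel R ts) \<longleftrightarrow> True"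
| "positive (Conj \<phi> \<psi>) \<longleftrightarrow> positive \<phi> \<and> positive \<psi>"
| "positive (Disj \<phi> \<psi>) \<longleftrightarrow> positive \<phi> \<and> positive \<psi>"
| "positive (Exists \<phi>) \<longleftrightarrow> positive \<phi>"
| "positive (Neg \<phi>) \<longleftrightarrow> False"
| "positive (Imp \<phi> \<psi>) \<longleftrightarrow> False"
| "positive (Forall \<phi>) \<longleftrightarrow> False"

lemma tm_val_closed:
  assumes "is_lstruct L M" "a \<in> tuples M n" "wf_tm L n t"
  shows "tm_val M a t \<in> carrier M"
  using assms(3)
proof (induction t)
  case (Var i)
  then show ?case using assms(2) by (auto simp: tuples_def)
next
  case (Cst c)
  then show ?case using assms(1) by (auto simp: is_lstruct_def)
next
  case (App f ts)
  have "map (tm_val M a) ts \<in> tuples M (fun_arity L f)"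
    using App by (auto simp: tuples_def)
  then show ?case using App.prems assms(1) by (auto simp: is_lstruct_def)
qed

lemma tm_val_morphism:
  assumes M: "is_lstruct L M" and h: "gstruct_morphism G L M N h"
    and a: "a \<in> tuples M n" and "wf_tm L n t"
  shows "tm_val N (map h a) t = h (tm_val M a t)"
  using assms(4)
proof (induction t)
  case (Var i)
  then show ?case using a by (auto simp: tuples_def)
next
  case (Cst c)
  then show ?case using h by (auto simp: gstruct_morphism_def)
next
  case (App f ts)
  have "map (tm_val M a) ts \<in> tuples M (fun_arity L f)"
    using App.prems tm_val_closed[OF M a] by (auto simp: tuples_def)
  moreover have "map (tm_val N (map h a)) ts = map h (map (tm_val M a) ts)"
    using App by auto
  moreover have "h (fun_int M f xs) = fun_int N f (map h xs)"
    if "xs \<in> tuples M (fun_arity L f)" for xs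
    using h App.prems that by (auto simp: gstruct_morphism_def)
  ultimately show ?case by (simp only: tm_val.simps)
qed

lemma sat_morphism:
  assumes M: "is_lstruct L M" and h: "gstruct_morphism G L M N h"
  shows "positive \<phi> \<Longrightarrow> wf_fm L n \<phi> \<Longrightarrow> a \<in> tuples M n \<Longrightarrow> sat M \<phi> a \<Longrightarrow> sat N \<phi> (map h a)"
proof (induction \<phi> arbitrary: n a)
  case (Eq s t)
  then show ?case using tm_val_morphism[OF M h] by auto
next
  case (Rel R ts)
  have "map (tm_val N (map h a)) ts = map h (map (tm_val M a) ts)"
    using Rel tm_val_morphism[OF M h] by auto
  moreover have "map h xs \<in> rel_int N R" if "xs \<in> rel_int M R" for xs
    using h Rel.prems that by (auto simp: gstruct_morphism_def)
  ultimately show ?case using Rel.prems(4) by (simp only: sat.simps)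
next
  case (Conj \<phi> \<psi>)
  then show ?case by auto
next
  case (Disj \<phi> \<psi>)
  then show ?case by auto
next
  case (Exists \<phi>)
  then obtain b where b: "b \<in> carrier M" "sat M \<phi> (a @ [b])" by auto
  have "a @ [b] \<in> tuples M (Suc n)" using Exists.prems b by (auto simp: tuples_def)
  then have "sat N \<phi> (map h (a @ [b]))"
    using Exists.IH[of "Suc n" "a @ [b]"] Exists.prems b by simp
  moreover have "h b \<in> carrier N" using b h by (auto simp: gstruct_morphism_def)
  ultimately show ?case by auto
qed auto

lemma restr_trans:
  assumes P: "gstruct_presheaf G L X P" and a: "a \<in> tuples (sec P U) n"
    and "openin X U" "openin X V" "openin X W" "W \<subseteq> V" "V \<subseteq> U"
  shows "restr P W V (restr P V U a) = restr P W U a"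
proof -
  have "res P W V (res P V U c) = res P W U c" if "c \<in> set a" for c
  proof -
    have "c \<in> carrier (sec P U)" using a that by (auto simp: tuples_def)
    then show ?thesis using P assms(3-) unfolding gstruct_presheaf_def by blast
  qed
  then show ?thesis by auto
qed

lemma presheaf_morphism:
  assumes "gstruct_presheaf G L X P" "openin X U" "openin X V" "V \<subseteq> U"
  shows "is_lstruct L (sec P U)" "gstruct_morphism G L (sec P U) (sec P V) (res P V U)"
  using assms by (auto simp: gstruct_presheaf_def is_gstruct_def)

lemma restr_closed:
  assumes "gstruct_presheaf G L X P" "a \<in> tuples (sec P U) n"
    and "openin X U" "openin X V" "V \<subseteq> U"
  shows "restr P V U a \<in> tuples (sec P V) n"
  using presheaf_morphism(2)[OF assms(1,3,4,5)] assms(2)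
  by (auto simp: tuples_def gstruct_morphism_def)

lemma sat_restr:
  assumes P: "gstruct_presheaf G L X P" and a: "a \<in> tuples (sec P U) n"
    and o: "openin X U" "openin X V" "openin X W" "W \<subseteq> V" "V \<subseteq> U"
    and p: "positive \<phi>" "wf_fm L n \<phi>" "sat (sec P V) \<phi> (restr P V U a)"
  shows "sat (sec P W) \<phi> (restr P W U a)"
  using sat_morphism[OF presheaf_morphism[OF P o(2,3,4)] p(1,2) restr_closed[OF P a o(1,2,5)] p(3)]
  by (simp only: restr_trans[OF P a o])

lemma force_positive:
  assumes P: "gstruct_presheaf G L X P"
  shows "positive \<phi> \<Longrightarrow> wf_fm L n \<phi> \<Longrightarrow> openin X U \<Longrightarrow> a \<in> tuples (sec P U) n \<Longrightarrow>
    force X P \<phi> x U a \<longleftrightarrow> (\<exists>V. open_nbhd X x U V \<and> sat (sec P V) \<phi> (restr P V U a))"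
proof (induction \<phi> arbitrary: n U a)
  case (Conj \<phi> \<psi>)
  show ?case (is "?l = ?r")
  proof
    assume ?l
    then obtain V W where V: "open_nbhd X x U V" "sat (sec P V) \<phi> (restr P V U a)"
      and W: "open_nbhd X x U W" "sat (sec P W) \<psi> (restr P W U a)"
      using Conj.IH(1)[of n U a] Conj.IH(2)[of n U a] Conj.prems by auto
    have o: "openin X V" "openin X W" "openin X (V \<inter> W)" "V \<subseteq> U" "W \<subseteq> U"
      using V W by (auto simp: open_nbhd_def)
    have "sat (sec P (V \<inter> W)) \<phi> (restr P (V \<inter> W) U a)"
      using sat_restr[OF P Conj.prems(4,3) o(1,3) _ o(4) _ _ V(2)] Conj.prems by simp
    moreover have "sat (sec P (V \<inter> W)) \<psi> (restr P (V \<inter> W) U a)"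
      using sat_restr[OF P Conj.prems(4,3) o(2,3) _ o(5) _ _ W(2)] Conj.prems by simp
    moreover have "open_nbhd X x U (V \<inter> W)" using V W by (auto simp: open_nbhd_def)
    ultimately show ?r by auto
  next
    assume ?r
    then show ?l using Conj.IH(1)[of n U a] Conj.IH(2)[of n U a] Conj.prems by auto
  qed
next
  case (Disj \<phi> \<psi>)
  then show ?case using Disj.IH(1)[of n U a] Disj.IH(2)[of n U a] by auto
next
  case (Exists \<phi>)
  have step: "force X P \<phi> x V (restr P V U a @ [b]) \<longleftrightarrow>
      (\<exists>W. open_nbhd X x V W \<and> sat (sec P W) \<phi> (restr P W U a @ [res P W V b]))"
    if V: "open_nbhd X x U V" and b: "b \<in> carrier (sec P V)" for V b
  proof -
    have o: "openin X V" "V \<subseteq> U" using V by (auto simp: open_nbhd_def)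
    have t: "restr P V U a @ [b] \<in> tuples (sec P V) (Suc n)"
      using restr_closed[OF P Exists.prems(4,3) o] b by (auto simp: tuples_def)
    have eq: "restr P W V (restr P V U a @ [b]) = restr P W U a @ [res P W V b]"
      if "open_nbhd X x V W" for W
    proof -
      have "openin X W" "W \<subseteq> V" using that by (auto simp: open_nbhd_def)
      then show ?thesis
        using restr_trans[OF P Exists.prems(4,3) o(1) _ _ o(2), of W] by simp
    qed
    show ?thesis
      using Exists.IH[of "Suc n" V "restr P V U a @ [b]"] Exists.prems(1,2) o t eq
      by (metis positive.simps(5) wf_fm.simps(7))
  qed
  show ?case (is "?l = ?r")
  proof
    assume ?l
    then obtain V b where V: "open_nbhd X x U V" and b: "b \<in> carrier (sec P V)"
      and "force X P \<phi> x V (restr P V U a @ [b])" by auto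
    then obtain W where W: "open_nbhd X x V W" "sat (sec P W) \<phi> (restr P W U a @ [res P W V b])"
      using step by blast
    have "openin X V" "openin X W" "W \<subseteq> V" using V W by (auto simp: open_nbhd_def)
    then have "res P W V b \<in> carrier (sec P W)"
      using presheaf_morphism(2)[OF P, of V W] b by (auto simp: gstruct_morphism_def)
    moreover have "open_nbhd X x U W" using V W by (auto simp: open_nbhd_def)
    ultimately show ?r using W by auto
  next
    assume ?r
    then obtain V b where V: "open_nbhd X x U V" and b: "b \<in> carrier (sec P V)"
      and s: "sat (sec P V) \<phi> (restr P V U a @ [b])" by auto
    have "res P V V b = b" using P V b by (auto simp: gstruct_presheaf_def open_nbhd_def)
    moreover have "open_nbhd X x V V" using V by (auto simp: open_nbhd_def)
    ultimately show ?l using step[OF V b] s V b by auto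
  qed
qed auto


section \<open>Generic filters and generic models\<close>

definition open_filter :: "'x topology \<Rightarrow> 'x set set \<Rightarrow> bool" where
  "open_filter X F \<longleftrightarrow>
     F \<noteq> {} \<and>
     (\<forall>U\<in>F. openin X U \<and> U \<noteq> {}) \<and>
     (\<forall>U\<in>F. \<forall>V\<in>F. U \<inter> V \<in> F) \<and>
     (\<forall>U\<in>F. \<forall>V. openin X V \<and> U \<subseteq> V \<longrightarrow> V \<in> F)"

definition generic_filter ::
    "'x topology \<Rightarrow> ('f, 'r, 'c) lang \<Rightarrow> ('x, 'g, 'f, 'r, 'c, 's) presheaf \<Rightarrow>
     'x set set \<Rightarrow> bool" where
  "generic_filter X L P F \<longleftrightarrow>
     (\<forall>n \<phi>. wf_fm L n \<phi> \<longrightarrow>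
        (\<forall>U\<in>F. \<forall>a\<in>tuples (sec P U) n. \<exists>V\<in>F. V \<subseteq> U \<and>
           (force_open X P \<phi> V (restr P V U a) \<or> force_open X P (Neg \<phi>) V (restr P V U a)))) \<and>
     (\<forall>n m \<phi>. wf_fm L (n + m) \<phi> \<longrightarrow>
        (\<forall>U\<in>F. \<forall>a\<in>tuples (sec P U) n. force_open X P ((Exists ^^ m) \<phi>) U a \<longrightarrow>
           (\<exists>V\<in>F. V \<subseteq> U \<and> (\<exists>b\<in>tuples (sec P V) m.
              force_open X P \<phi> V (restr P V U a @ b)))))"

definition germ_rel ::
    "('x, 'g, 'f, 'r, 'c, 's) presheaf \<Rightarrow> 'x set set \<Rightarrow> (('x set \<times> 's) \<times> ('x set \<times> 's)) set" where
  "germ_rel P F = {((U, a), (V, b)) | U a V b.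
     U \<in> F \<and> a \<in> carrier (sec P U) \<and> V \<in> F \<and> b \<in> carrier (sec P V) \<and>
     (\<exists>W\<in>F. W \<subseteq> U \<inter> V \<and> res P W U a = res P W V b)}"

definition germ ::
    "('x, 'g, 'f, 'r, 'c, 's) presheaf \<Rightarrow> 'x set set \<Rightarrow> 'x set \<Rightarrow> 's \<Rightarrow> ('x set \<times> 's) set" where
  "germ P F U a = germ_rel P F `` {(U, a)}"

definition germs ::
    "('x, 'g, 'f, 'r, 'c, 's) presheaf \<Rightarrow> 'x set set \<Rightarrow> ('x set \<times> 's) set set" where
  "germs P F = (SIGMA U:F. carrier (sec P U)) // germ_rel P F"

text \<open>
  The action is made extensional on the set of germs, as \<^locale>\<open>group_action\<close> demands.
\<close>

definition colim_struct ::
    "('x, 'g, 'f, 'r, 'c, 's) presheaf \<Rightarrow> 'x set set \<Rightarrow>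
     ('g, 'f, 'r, 'c, ('x set \<times> 's) set) gstruct" where
  "colim_struct P F = \<lparr>
     carrier = germs P F,
     fun_int = (\<lambda>f \<gamma>s. THE \<delta>. \<exists>W\<in>F. \<exists>as. set as \<subseteq> carrier (sec P W) \<and>
        \<gamma>s = map (germ P F W) as \<and> \<delta> = germ P F W (fun_int (sec P W) f as)),
     rel_int = (\<lambda>R. {\<gamma>s. \<exists>W\<in>F. \<exists>as\<in>rel_int (sec P W) R. \<gamma>s = map (germ P F W) as}),
     const_int = (\<lambda>c. THE \<delta>. \<exists>W\<in>F. \<delta> = germ P F W (const_int (sec P W) c)),
     act = (\<lambda>g. \<lambda>\<gamma>\<in>germs P F. THE \<delta>. \<exists>W\<in>F. \<exists>a\<in>carrier (sec P W).
        \<gamma> = germ P F W a \<and> \<delta> = germ P F W (act (sec P W) g a)) \<rparr>"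

end

theory Submission
  imports Defs
begin

text \<open>
  Any maximal filter of open sets is generic, and its colimit is a \<open>G\<close>-structure; the filter
  exists by Zorn's lemma because the space is nonempty.

  The property of a maximal filter that makes this work is that it contains every open set meeting
  all of its members (\<open>maximal_filter_memI\<close>). What has to be known about
  forcing is that it is a local and open condition: whether a point forces \<open>\<phi>(a)\<close> does not change
  when \<open>a\<close> is restricted to a smaller neighbourhood (\<open>force_restr\<close>), and if a point forces \<open>\<phi>(a)\<close>
  then so do all nearby points (\<open>force_nearby\<close>).

  Deciding formulas: the points of \<open>U\<close> that force \<open>\<phi>(a)\<close> form an open set \<open>V\<close>. Either \<open>V\<close> meets every
  member of the filter, and then belongs to it, or \<open>V\<close> misses some member \<open>W\<close>, and then all points
  of \<open>U \<inter> W\<close> force the negation.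

  Witnesses: if \<open>\<exists>w \<phi>(a, w)\<close> is forced on \<open>U\<close>, then witnesses exist locally around each point. There is
  no reason for them to agree on overlaps, so one takes a maximal family of pairwise
  disjoint open sets that carry a witness. Compatibility is then automatic, exactness
  glues the witnesses to one section over the union, and maximality makes the union
  dense in \<open>U\<close>, hence a member of the filter (\<open>dense_witness\<close>).

  The colimit needs only that the filter is directed: finitely many germs have representatives over
  one member of the filter, and finitely many equations between germs already hold over
  one member. So each axiom of a \<open>G\<close>-structure is inherited from the structures of sections.
\<close>

section \<open>Maximal filters of open sets\<close>

definition maximal_filter :: "'x topology \<Rightarrow> 'x set set \<Rightarrow> bool" where
  "maximal_filter X F \<longleftrightarrow> open_filter X F \<and> (\<forall>F'. open_filter X F' \<and> F \<subseteq> F' \<longrightarrow> F' = F)"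

lemma open_filterD:
  assumes "open_filter X F"
  shows "F \<noteq> {}" "\<And>U. U \<in> F \<Longrightarrow> openin X U" "\<And>U. U \<in> F \<Longrightarrow> U \<noteq> {}"
    "\<And>U V. U \<in> F \<Longrightarrow> V \<in> F \<Longrightarrow> U \<inter> V \<in> F"
    "\<And>U V. U \<in> F \<Longrightarrow> openin X V \<Longrightarrow> U \<subseteq> V \<Longrightarrow> V \<in> F"
  using assms unfolding open_filter_def by (fast, fast, fast, fast, fast)

lemma open_filter_Union_chain:
  assumes "\<C> \<noteq> {}" and chain: "subset.chain {F. open_filter X F} \<C>"
  shows "open_filter X (\<Union>\<C>)"
proof -
  have filt: "open_filter X F" if "F \<in> \<C>" for F
    using chain that by (auto simp: subset.chain_def)
  have lin: "F \<subseteq> F' \<or> F' \<subseteq> F" if "F \<in> \<C>" "F' \<in> \<C>" for F F'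
    using chain that by (auto simp: subset.chain_def)
  show ?thesis
    unfolding open_filter_def
  proof (intro conjI ballI allI impI)
    obtain F where "F \<in> \<C>" using assms(1) by blast
    then show "\<Union>\<C> \<noteq> {}" using open_filterD(1)[OF filt] by blast
  next
    fix U assume "U \<in> \<Union>\<C>"
    then show "openin X U" "U \<noteq> {}" using open_filterD(2,3)[OF filt] by blast+
  next
    fix U V assume "U \<in> \<Union>\<C>" "V \<in> \<Union>\<C>"
    then obtain F F' where "F \<in> \<C>" "U \<in> F" "F' \<in> \<C>" "V \<in> F'" by blast
    then obtain F'' where "F'' \<in> \<C>" "U \<in> F''" "V \<in> F''" using lin by blast
    then show "U \<inter> V \<in> \<Union>\<C>" using open_filterD(4)[OF filt] by blast
  next
    fix U V assume "U \<in> \<Union>\<C>" "openin X V \<and> U \<subseteq> V"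
    then show "V \<in> \<Union>\<C>" using open_filterD(5)[OF filt] by blast
  qed
qed

lemma maximal_filter_exists:
  assumes "topspace X \<noteq> {}"
  shows "\<exists>F. maximal_filter X F"
proof -
  have "open_filter X {topspace X}"
    using assms openin_subset by (fastforce simp: open_filter_def)
  then have "\<exists>F\<in>{F. open_filter X F}. \<forall>F'\<in>{F. open_filter X F}. F \<subseteq> F' \<longrightarrow> F' = F"
    using open_filter_Union_chain by (intro subset_Zorn_nonempty) auto
  then show ?thesis by (auto simp: maximal_filter_def)
qed

text \<open>Otherwise the open sets containing some \<open>V \<inter> U\<close> with \<open>V \<in> F\<close> would form a larger filter.\<close>

lemma maximal_filter_memI:
  assumes F: "maximal_filter X F" and U: "openin X U"
    and meets: "\<And>V. V \<in> F \<Longrightarrow> V \<inter> U \<noteq> {}"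
  shows "U \<in> F"
proof -
  have filt: "open_filter X F" using F by (simp add: maximal_filter_def)
  let ?F' = "{W. openin X W \<and> (\<exists>V\<in>F. V \<inter> U \<subseteq> W)}"
  have "open_filter X ?F'"
    unfolding open_filter_def
  proof (intro conjI ballI allI impI)
    show "?F' \<noteq> {}" using open_filterD(1)[OF filt] U by blast
  next
    fix W assume "W \<in> ?F'"
    then show "openin X W" "W \<noteq> {}" using meets by blast+
  next
    fix W W' assume "W \<in> ?F'" "W' \<in> ?F'"
    then obtain V V' where "V \<in> F" "V' \<in> F" "V \<inter> U \<subseteq> W" "V' \<inter> U \<subseteq> W'"
      and o: "openin X W" "openin X W'" by blast
    then have "V \<inter> V' \<in> F" "V \<inter> V' \<inter> U \<subseteq> W \<inter> W'"
      using open_filterD(4)[OF filt] by blast+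
    then show "W \<inter> W' \<in> ?F'" using o by blast
  qed blast
  moreover have "F \<subseteq> ?F'" using open_filterD(2)[OF filt] by blast
  ultimately have "?F' = F" using F by (simp add: maximal_filter_def)
  moreover have "U \<in> ?F'" using U open_filterD(1)[OF filt] by blast
  ultimately show ?thesis by simp
qed


section \<open>Forcing is local and open\<close>

locale presheaf_of_gstructures =
  fixes G :: "('g, 'k) monoid_scheme"
    and L :: "('f, 'r, 'c) lang"
    and X :: "'x topology"
    and P :: "('x, 'g, 'f, 'r, 'c, 's) presheaf"
  assumes presheaf: "gstruct_presheaf G L X P"
begin

lemma res_closed:
  "openin X U \<Longrightarrow> openin X V \<Longrightarrow> V \<subseteq> U \<Longrightarrow> b \<in> carrier (sec P U) \<Longrightarrow>
    res P V U b \<in> carrier (sec P V)"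
  using presheaf_morphism(2)[OF presheaf] by (auto simp: gstruct_morphism_def)

lemma res_id: "openin X U \<Longrightarrow> b \<in> carrier (sec P U) \<Longrightarrow> res P U U b = b"
  using presheaf by (auto simp: gstruct_presheaf_def)

lemma res_trans:
  "openin X U \<Longrightarrow> openin X V \<Longrightarrow> openin X W \<Longrightarrow> W \<subseteq> V \<Longrightarrow> V \<subseteq> U \<Longrightarrow> b \<in> carrier (sec P U) \<Longrightarrow>
    res P W V (res P V U b) = res P W U b"
  using presheaf unfolding gstruct_presheaf_def by blast

lemma restr_id: "openin X U \<Longrightarrow> a \<in> tuples (sec P U) n \<Longrightarrow> restr P U U a = a"
  by (auto simp: tuples_def res_id intro!: map_idI)

text \<open>A condition of the form ``some neighbourhood of \<open>x\<close> inside \<open>U\<close> is good'' does not depend on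
  \<open>U\<close>, provided goodness passes to smaller sets. This settles the clauses of forcing
  that ask for a neighbourhood, except the one for \<open>Exists\<close>, where the witness has to be restricted too.\<close>

lemma open_nbhd_shrink:
  assumes "openin X V" "V \<subseteq> U" "x \<in> V"
    and shrink: "\<And>W W'. open_nbhd X x U W \<Longrightarrow> open_nbhd X x W W' \<Longrightarrow> Q W \<Longrightarrow> Q W'"
    and agree: "\<And>W. open_nbhd X x V W \<Longrightarrow> Q' W \<longleftrightarrow> Q W"
  shows "(\<exists>W. open_nbhd X x V W \<and> Q' W) \<longleftrightarrow> (\<exists>W. open_nbhd X x U W \<and> Q W)"
proof
  assume "\<exists>W. open_nbhd X x U W \<and> Q W"
  then obtain W where W: "open_nbhd X x U W" "Q W" by blast
  have "open_nbhd X x W (W \<inter> V)" "open_nbhd X x V (W \<inter> V)"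
    using W(1) assms(1,3) by (auto simp: open_nbhd_def)
  then show "\<exists>W. open_nbhd X x V W \<and> Q' W" using shrink agree W by blast
next
  assume "\<exists>W. open_nbhd X x V W \<and> Q' W"
  then obtain W where W: "open_nbhd X x V W" "Q W" using agree by blast
  moreover have "open_nbhd X x U W" using W(1) assms(2) by (auto simp: open_nbhd_def)
  ultimately show "\<exists>W. open_nbhd X x U W \<and> Q W" by blast
qed

lemma atomic_restr:
  assumes "positive \<phi>" "wf_fm L n \<phi>" "openin X U" "openin X V" "V \<subseteq> U" "x \<in> V"
    and a: "a \<in> tuples (sec P U) n"
  shows "(\<exists>W. open_nbhd X x V W \<and> sat (sec P W) \<phi> (restr P W V (restr P V U a))) \<longleftrightarrow>
    (\<exists>W. open_nbhd X x U W \<and> sat (sec P W) \<phi> (restr P W U a))"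
proof (rule open_nbhd_shrink[OF assms(4-6)])
  fix W W' assume "open_nbhd X x U W" "open_nbhd X x W W'"
    and "sat (sec P W) \<phi> (restr P W U a)"
  then show "sat (sec P W') \<phi> (restr P W' U a)"
    using sat_restr[OF presheaf a assms(3) _ _ _ _ assms(1,2)] unfolding open_nbhd_def by blast
next
  fix W assume "open_nbhd X x V W"
  then have "restr P W V (restr P V U a) = restr P W U a"
    using restr_trans[OF presheaf a assms(3,4)] assms(5) by (simp add: open_nbhd_def)
  then show "sat (sec P W) \<phi> (restr P W V (restr P V U a)) \<longleftrightarrow>
      sat (sec P W) \<phi> (restr P W U a)" by (simp only:)
qed

lemma force_restr:
  "wf_fm L n \<phi> \<Longrightarrow> openin X U \<Longrightarrow> openin X V \<Longrightarrow> V \<subseteq> U \<Longrightarrow> x \<in> V \<Longrightarrow> a \<in> tuples (sec P U) n \<Longrightarrow>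
    force X P \<phi> x V (restr P V U a) \<longleftrightarrow> force X P \<phi> x U a"
proof (induction \<phi> arbitrary: n x U V a)
  case (Eq s t)
  then show ?case using atomic_restr[of "Eq s t" n U V x a] by (simp only: force.simps positive.simps)
next
  case (Rel R ts)
  then show ?case using atomic_restr[of "Rel R ts" n U V x a] by (simp only: force.simps positive.simps)
next
  case (Conj \<phi> \<psi>)
  then show ?case by (metis force.simps(3) wf_fm.simps(3))
next
  case (Disj \<phi> \<psi>)
  then show ?case by (metis force.simps(4) wf_fm.simps(4))
next
  case (Neg \<phi>)
  have IH: "force X P \<phi> y V (restr P V U a) \<longleftrightarrow> force X P \<phi> y U a" if "y \<in> V" for y
    using Neg.IH[of n U V y a] Neg.prems that by simp
  show ?case
    unfolding force.simps
  proof (rule open_nbhd_shrink[OF Neg.prems(3-5)])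
    fix W assume "open_nbhd X x V W"
    then have "W \<subseteq> V" by (simp add: open_nbhd_def)
    then show "(\<forall>y\<in>W. \<not> force X P \<phi> y V (restr P V U a)) \<longleftrightarrow> (\<forall>y\<in>W. \<not> force X P \<phi> y U a)"
      using IH by blast
  qed (auto simp: open_nbhd_def)
next
  case (Imp \<phi> \<psi>)
  have IH: "force X P \<phi> y V (restr P V U a) \<longleftrightarrow> force X P \<phi> y U a"
    "force X P \<psi> y V (restr P V U a) \<longleftrightarrow> force X P \<psi> y U a" if "y \<in> V" for y
    using Imp.IH(1)[of n U V y a] Imp.IH(2)[of n U V y a] Imp.prems that by simp_all
  show ?case
    unfolding force.simps
  proof (rule open_nbhd_shrink[OF Imp.prems(3-5)])
    fix W assume "open_nbhd X x V W"
    then have "W \<subseteq> V" by (simp add: open_nbhd_def)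
    then show "(\<forall>y\<in>W. force X P \<phi> y V (restr P V U a) \<longrightarrow> force X P \<psi> y V (restr P V U a)) \<longleftrightarrow>
        (\<forall>y\<in>W. force X P \<phi> y U a \<longrightarrow> force X P \<psi> y U a)"
      using IH by blast
  qed (auto simp: open_nbhd_def)
next
  case (Exists \<phi>)
  note trans = restr_trans[OF presheaf Exists.prems(6,2)]
  show ?case
  proof
    assume "force X P (Exists \<phi>) x V (restr P V U a)"
    then obtain W b where W: "open_nbhd X x V W" and b: "b \<in> carrier (sec P W)"
      and f: "force X P \<phi> x W (restr P W V (restr P V U a) @ [b])" by auto
    have "restr P W V (restr P V U a) = restr P W U a"
      using trans[of V W] W Exists.prems by (auto simp: open_nbhd_def)
    moreover have "open_nbhd X x U W" using W Exists.prems by (auto simp: open_nbhd_def)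
    ultimately show "force X P (Exists \<phi>) x U a"
      using f b unfolding force.simps by (metis (no_types))
  next
    assume "force X P (Exists \<phi>) x U a"
    then obtain W b where W: "open_nbhd X x U W" and b: "b \<in> carrier (sec P W)"
      and f: "force X P \<phi> x W (restr P W U a @ [b])" by auto
    let ?W = "W \<inter> V"
    have o: "openin X W" "W \<subseteq> U" "openin X ?W" "x \<in> ?W"
      using W Exists.prems by (auto simp: open_nbhd_def)
    have t: "restr P W U a @ [b] \<in> tuples (sec P W) (Suc n)"
      using restr_closed[OF presheaf Exists.prems(6,2) o(1,2)] b by (auto simp: tuples_def)
    have "force X P \<phi> x ?W (restr P ?W W (restr P W U a @ [b]))"
      using Exists.IH[OF _ o(1,3) _ o(4) t] f Exists.prems by simp
    moreover have "restr P ?W W (restr P W U a @ [b]) =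
        restr P ?W V (restr P V U a) @ [res P ?W W b]"
      using trans[of W ?W] trans[of V ?W] o Exists.prems by simp
    ultimately have "force X P \<phi> x ?W (restr P ?W V (restr P V U a) @ [res P ?W W b])"
      by (simp only:)
    moreover have "open_nbhd X x V ?W" using o by (auto simp: open_nbhd_def)
    moreover have "res P ?W W b \<in> carrier (sec P ?W)" using res_closed o b by simp
    ultimately show "force X P (Exists \<phi>) x V (restr P V U a)"
      unfolding force.simps by blast
  qed
next
  case (Forall \<phi>)
  have eq: "restr P W V (restr P V U a) = restr P W U a" if "openin X W" "W \<subseteq> V" for W
    using restr_trans[OF presheaf Forall.prems(6,2,3)] that Forall.prems by simp
  show ?case
    unfolding force.simps
  proof (rule open_nbhd_shrink[OF Forall.prems(3-5)])
    fix V' V''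
    assume "open_nbhd X x V' V''" and "\<forall>y\<in>V'. \<forall>W. open_nbhd X y V' W \<longrightarrow>
      (\<forall>b\<in>carrier (sec P W). force X P \<phi> y W (restr P W U a @ [b]))"
    then show "\<forall>y\<in>V''. \<forall>W. open_nbhd X y V'' W \<longrightarrow>
      (\<forall>b\<in>carrier (sec P W). force X P \<phi> y W (restr P W U a @ [b]))"
      unfolding open_nbhd_def by blast
  next
    fix V' assume "open_nbhd X x V V'"
    then have "restr P W V (restr P V U a) = restr P W U a" if "open_nbhd X y V' W" for y W
      using that by (intro eq) (auto simp: open_nbhd_def)
    then show "(\<forall>y\<in>V'. \<forall>W. open_nbhd X y V' W \<longrightarrow> (\<forall>b\<in>carrier (sec P W).
          force X P \<phi> y W (restr P W V (restr P V U a) @ [b]))) \<longleftrightarrow>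
        (\<forall>y\<in>V'. \<forall>W. open_nbhd X y V' W \<longrightarrow> (\<forall>b\<in>carrier (sec P W).
          force X P \<phi> y W (restr P W U a @ [b])))"
      by (simp del: map_map)
  qed
qed

text \<open>A clause of forcing that asks for a neighbourhood of the point is satisfied with the same
  neighbourhood by all its points. In the clause for \<open>Exists\<close> the witness is kept and the
  neighbourhood shrinks to one where it still works.\<close>

lemma force_nearby:
  "wf_fm L n \<phi> \<Longrightarrow> openin X U \<Longrightarrow> a \<in> tuples (sec P U) n \<Longrightarrow> force X P \<phi> x U a \<Longrightarrow> x \<in> U \<Longrightarrow>
    \<exists>V. open_nbhd X x U V \<and> (\<forall>y\<in>V. force X P \<phi> y U a)"
proof (induction \<phi> arbitrary: n x U a)
  case (Eq s t)
  then obtain V where "open_nbhd X x U V" "sat (sec P V) (Eq s t) (restr P V U a)"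
    unfolding force.simps by blast
  moreover from this have "open_nbhd X y U V" if "y \<in> V" for y
    using that by (auto simp: open_nbhd_def)
  ultimately show ?case unfolding force.simps by blast
next
  case (Rel R ts)
  then obtain V where "open_nbhd X x U V" "sat (sec P V) (Rel R ts) (restr P V U a)"
    unfolding force.simps by blast
  moreover from this have "open_nbhd X y U V" if "y \<in> V" for y
    using that by (auto simp: open_nbhd_def)
  ultimately show ?case unfolding force.simps by blast
next
  case (Conj \<phi> \<psi>)
  then obtain V W where "open_nbhd X x U V" "\<forall>y\<in>V. force X P \<phi> y U a"
    "open_nbhd X x U W" "\<forall>y\<in>W. force X P \<psi> y U a" by (metis force.simps(3) wf_fm.simps(3))
  then show ?case by (intro exI[of _ "V \<inter> W"]) (auto simp: open_nbhd_def)
next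
  case (Disj \<phi> \<psi>)
  then show ?case by (metis force.simps(4) wf_fm.simps(4))
next
  case (Neg \<phi>)
  then obtain V where "open_nbhd X x U V" "\<forall>y\<in>V. \<not> force X P \<phi> y U a" by auto
  moreover from this have "open_nbhd X y U V" if "y \<in> V" for y
    using that by (auto simp: open_nbhd_def)
  ultimately show ?case unfolding force.simps by blast
next
  case (Imp \<phi> \<psi>)
  then obtain V where "open_nbhd X x U V"
    "\<forall>y\<in>V. force X P \<phi> y U a \<longrightarrow> force X P \<psi> y U a" by auto
  moreover from this have "open_nbhd X y U V" if "y \<in> V" for y
    using that by (auto simp: open_nbhd_def)
  ultimately show ?case unfolding force.simps by blast
next
  case (Exists \<phi>)
  then obtain V b where V: "open_nbhd X x U V" and b: "b \<in> carrier (sec P V)"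
    and f: "force X P \<phi> x V (restr P V U a @ [b])" by auto
  have o: "openin X V" "V \<subseteq> U" "x \<in> V" using V by (auto simp: open_nbhd_def)
  have "restr P V U a @ [b] \<in> tuples (sec P V) (Suc n)"
    using restr_closed[OF presheaf Exists.prems(3,2) o(1,2)] b by (auto simp: tuples_def)
  then obtain W where W: "open_nbhd X x V W"
      "\<forall>y\<in>W. force X P \<phi> y V (restr P V U a @ [b])"
    using Exists.IH[OF _ o(1) _ f o(3)] Exists.prems(1) by auto
  have "open_nbhd X y U V" if "y \<in> W" for y using that W V by (auto simp: open_nbhd_def)
  moreover have "open_nbhd X x U W" using W V by (auto simp: open_nbhd_def)
  ultimately show ?case using W(2) b unfolding force.simps by blast
next
  case (Forall \<phi>)
  then obtain V where "open_nbhd X x U V" "\<forall>y\<in>V. \<forall>W. open_nbhd X y V W \<longrightarrow>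
      (\<forall>b\<in>carrier (sec P W). force X P \<phi> y W (restr P W U a @ [b]))"
    unfolding force.simps by blast
  moreover from this have "open_nbhd X y U V" if "y \<in> V" for y
    using that by (auto simp: open_nbhd_def)
  ultimately show ?case unfolding force.simps by blast
qed

lemma openin_forcing_points:
  assumes "wf_fm L n \<phi>" "openin X U" "a \<in> tuples (sec P U) n"
  shows "openin X {x \<in> U. force X P \<phi> x U a}"
proof (subst openin_subopen, intro ballI)
  fix x assume "x \<in> {x \<in> U. force X P \<phi> x U a}"
  then obtain V where "open_nbhd X x U V" "\<forall>y\<in>V. force X P \<phi> y U a"
    using force_nearby[OF assms] by blast
  then show "\<exists>V. openin X V \<and> x \<in> V \<and> V \<subseteq> {x \<in> U. force X P \<phi> x U a}"
    by (intro exI[of _ V]) (auto simp: open_nbhd_def)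
qed

lemma force_open_restr:
  assumes "wf_fm L n \<phi>" "openin X U" "openin X V" "V \<subseteq> U" "a \<in> tuples (sec P U) n"
  shows "force_open X P \<phi> V (restr P V U a) \<longleftrightarrow> (\<forall>x\<in>V. force X P \<phi> x U a)"
  using force_restr[OF assms(1-4) _ assms(5)] by (simp add: force_open_def)

end


section \<open>Maximal filters are generic\<close>

locale presheaf_with_filter = presheaf_of_gstructures G L X P
  for G :: "('g, 'k) monoid_scheme"
    and L :: "('f, 'r, 'c) lang"
    and X :: "'x topology"
    and P :: "('x, 'g, 'f, 'r, 'c, 's) presheaf" +
  fixes F :: "'x set set"
  assumes filt: "open_filter X F"
begin

lemmas mem_open = open_filterD(2)[OF filt]
  and mem_nonempty = open_filterD(3)[OF filt]
  and mem_Int = open_filterD(4)[OF filt]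

lemma filter_decides:
  assumes max: "maximal_filter X F" and wf: "wf_fm L n \<phi>" and U: "U \<in> F"
    and a: "a \<in> tuples (sec P U) n"
  shows "\<exists>V\<in>F. V \<subseteq> U \<and>
    (force_open X P \<phi> V (restr P V U a) \<or> force_open X P (Neg \<phi>) V (restr P V U a))"
proof -
  define V where "V = {x \<in> U. force X P \<phi> x U a}"
  have oU: "openin X U" using U by (rule mem_open)
  have oV: "openin X V" "V \<subseteq> U"
    using openin_forcing_points[OF wf oU a] by (auto simp: V_def)
  show ?thesis
  proof (cases "\<forall>W\<in>F. W \<inter> V \<noteq> {}")
    case True
    then have "V \<in> F" using maximal_filter_memI[OF max oV(1)] by blast
    moreover have "force_open X P \<phi> V (restr P V U a)"
      using force_open_restr[OF wf oU oV a] by (simp add: V_def)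
    ultimately show ?thesis using oV(2) by blast
  next
    case False
    then obtain W where W: "W \<in> F" "W \<inter> V = {}" by blast
    let ?W = "U \<inter> W"
    have WF: "?W \<in> F" using U W by (intro mem_Int)
    then have oW: "openin X ?W" by (rule mem_open)
    have "force X P (Neg \<phi>) x U a" if "x \<in> ?W" for x
      using that oW W(2) by (auto simp: open_nbhd_def V_def intro!: exI[of _ ?W])
    then have "force_open X P (Neg \<phi>) ?W (restr P ?W U a)"
      using force_open_restr[of n "Neg \<phi>", OF _ oU oW _ a] wf by auto
    then show ?thesis using WF by blast
  qed
qed

end

lemma maximal_disjoint_subfamily:
  "\<exists>\<U>\<subseteq>\<D>. pairwise disjnt \<U> \<and> (\<forall>D\<in>\<D>. D \<inter> \<Union>\<U> = {} \<longrightarrow> D = {})"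
proof -
  let ?A = "{\<U>. \<U> \<subseteq> \<D> \<and> pairwise disjnt \<U>}"
  have "\<Union>\<C> \<in> ?A" if chain: "subset.chain ?A \<C>" for \<C>
  proof -
    have lin: "\<U> \<subseteq> \<V> \<or> \<V> \<subseteq> \<U>" if "\<U> \<in> \<C>" "\<V> \<in> \<C>" for \<U> \<V>
      using chain that unfolding subset.chain_def by blast
    have sub: "\<U> \<subseteq> \<D>" "pairwise disjnt \<U>" if "\<U> \<in> \<C>" for \<U>
      using chain that by (auto simp: subset.chain_def)
    have "pairwise disjnt (\<Union>\<C>)"
    proof (rule pairwiseI)
      fix A B assume "A \<in> \<Union>\<C>" "B \<in> \<Union>\<C>" "A \<noteq> B"
      then obtain \<U> where "\<U> \<in> \<C>" "A \<in> \<U>" "B \<in> \<U>" using lin by blast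
      then show "disjnt A B" using sub(2)[of \<U>] \<open>A \<noteq> B\<close> by (auto simp: pairwise_def)
    qed
    then show ?thesis using sub by blast
  qed
  then obtain \<U> where \<U>: "\<U> \<in> ?A" and max: "\<And>\<V>. \<V> \<in> ?A \<Longrightarrow> \<U> \<subseteq> \<V> \<Longrightarrow> \<V> = \<U>"
    using subset_Zorn_nonempty[of ?A] by (auto simp: subset.chain_def)
  have "D = {}" if D: "D \<in> \<D>" "D \<inter> \<Union>\<U> = {}" for D
  proof -
    have "insert D \<U> \<in> ?A"
      using D \<U> by (auto simp: pairwise_insert disjnt_def)
    then have "insert D \<U> = \<U>" using max by blast
    then show ?thesis using D(2) by blast
  qed
  then show ?thesis using \<U> by blast
qed

context presheaf_of_gstructures
begin

text \<open>A disjoint family of sections is compatible because there is only one section over the empty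
  set. So a witness on a dense part of \<open>U\<close> can be glued from local ones.\<close>

lemma dense_witness:
  assumes exact: "exact_presheaf X P" and wf: "wf_fm L (Suc n) \<phi>" and U: "openin X U"
    and a: "a \<in> tuples (sec P U) n" and f: "force_open X P (Exists \<phi>) U a"
  obtains W s where "openin X W" "W \<subseteq> U" "s \<in> carrier (sec P W)"
    "force_open X P \<phi> W (restr P W U a @ [s])"
    "\<And>D. openin X D \<Longrightarrow> D \<subseteq> U \<Longrightarrow> D \<noteq> {} \<Longrightarrow> D \<inter> W \<noteq> {}"
proof -
  define good where
    "good V b \<longleftrightarrow> b \<in> carrier (sec P V) \<and> force_open X P \<phi> V (restr P V U a @ [b])" for V b
  define \<D> where "\<D> = {V. openin X V \<and> V \<subseteq> U \<and> (\<exists>b. good V b)}"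
  have tup: "restr P V U a @ [b] \<in> tuples (sec P V) (Suc n)"
    if "openin X V" "V \<subseteq> U" "b \<in> carrier (sec P V)" for V b
    using restr_closed[OF presheaf a U that(1,2)] that(3) by (auto simp: tuples_def)
  have restr_snoc: "restr P V' V (restr P V U a @ [b]) = restr P V' U a @ [res P V' V b]"
    if "openin X V" "V \<subseteq> U" "openin X V'" "V' \<subseteq> V" for V V' b
    using restr_trans[OF presheaf a U that(1,3,4,2)] by simp
  obtain \<U> where \<U>: "\<U> \<subseteq> \<D>" "pairwise disjnt \<U>"
    and max: "\<forall>D\<in>\<D>. D \<inter> \<Union>\<U> = {} \<longrightarrow> D = {}"
    using maximal_disjoint_subfamily[of \<D>] by blast
  define \<beta> where "\<beta> V = (SOME b. good V b)" for V
  have oV: "openin X V" "V \<subseteq> U" and good: "good V (\<beta> V)" if "V \<in> \<U>" for V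
  proof -
    have "V \<in> \<D>" using that \<U>(1) by blast
    then show "openin X V" "V \<subseteq> U" "good V (\<beta> V)"
      unfolding \<beta>_def \<D>_def by (auto intro: someI)
  qed
  have \<beta>: "\<beta> V \<in> carrier (sec P V)" "force_open X P \<phi> V (restr P V U a @ [\<beta> V])" if "V \<in> \<U>" for V
    using good[OF that] by (simp_all add: good_def)
  let ?W = "\<Union>\<U>"
  have oW: "openin X ?W" "?W \<subseteq> U" using oV by (auto intro: openin_Union)
  have comp: "res P (V \<inter> V') V (\<beta> V) = res P (V \<inter> V') V' (\<beta> V')" if "V \<in> \<U>" "V' \<in> \<U>" for V V'
  proof (cases "V = V'")
    case False
    then have e: "V \<inter> V' = {}" using \<U>(2) that by (auto simp: pairwise_def disjnt_def)
    have "res P {} V (\<beta> V) \<in> carrier (sec P {})" "res P {} V' (\<beta> V') \<in> carrier (sec P {})"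
      using that \<beta>(1) oV by (auto intro: res_closed)
    moreover obtain e where "carrier (sec P {}) = {e}"
      using presheaf by (auto simp: gstruct_presheaf_def)
    ultimately show ?thesis using e by simp
  qed simp
  have "\<exists>s\<in>carrier (sec P ?W). \<forall>V\<in>\<U>. res P V ?W s = \<beta> V"
    using exact[unfolded exact_presheaf_def, rule_format, of \<U> \<beta>] \<beta>(1) oV comp by blast
  then obtain s where s: "s \<in> carrier (sec P ?W)" "\<And>V. V \<in> \<U> \<Longrightarrow> res P V ?W s = \<beta> V"
    by blast
  have "force X P \<phi> x ?W (restr P ?W U a @ [s])" if x: "x \<in> V" and V: "V \<in> \<U>" for x V
  proof -
    have "restr P V ?W (restr P ?W U a @ [s]) = restr P V U a @ [\<beta> V]"
      using restr_snoc[OF oW oV(1)[OF V], of s] s(2)[OF V] V by auto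
    then have "force X P \<phi> x V (restr P V ?W (restr P ?W U a @ [s]))"
      using \<beta>(2)[OF V] x by (simp only: force_open_def)
    then show ?thesis
      using force_restr[OF wf oW(1) oV(1)[OF V] _ x tup[OF oW s(1)]] V by blast
  qed
  then have "force_open X P \<phi> ?W (restr P ?W U a @ [s])" by (auto simp: force_open_def)
  \<comment> \<open>Otherwise a witness near a point of \<open>D\<close>, restricted to \<open>D\<close>, would enlarge the family.\<close>
  moreover have "D \<inter> ?W \<noteq> {}" if D: "openin X D" "D \<subseteq> U" "D \<noteq> {}" for D
  proof
    assume disj: "D \<inter> ?W = {}"
    obtain x where x: "x \<in> D" using D by blast
    then have "force X P (Exists \<phi>) x U a" using f D by (auto simp: force_open_def)
    then obtain V b where V: "open_nbhd X x U V" and b: "b \<in> carrier (sec P V)"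
      and fx: "force X P \<phi> x V (restr P V U a @ [b])" by auto
    have o: "openin X V" "V \<subseteq> U" "x \<in> V" using V by (auto simp: open_nbhd_def)
    obtain V' where V': "open_nbhd X x V V'" "\<forall>y\<in>V'. force X P \<phi> y V (restr P V U a @ [b])"
      using force_nearby[OF wf o(1) tup[OF o(1,2) b] fx o(3)] by blast
    let ?E = "V' \<inter> D"
    have oE: "openin X ?E" "?E \<subseteq> V" "x \<in> ?E" using V' D x by (auto simp: open_nbhd_def)
    have "force_open X P \<phi> ?E (restr P ?E V (restr P V U a @ [b]))"
      using force_open_restr[OF wf o(1) oE(1,2) tup[OF o(1,2) b]] V'(2) by blast
    then have "good ?E (res P ?E V b)"
      unfolding good_def
      using restr_snoc[OF o(1,2) oE(1,2), of b] res_closed[OF o(1) oE(1,2) b] by (simp only:)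
    then have "?E \<in> \<D>" unfolding \<D>_def using oE o(2) by blast
    moreover have "?E \<inter> \<Union>\<U> = {}" using disj by blast
    ultimately have "?E = {}" using max by (simp only:)
    then show False using oE(3) by (simp only: empty_iff)
  qed
  ultimately show ?thesis using that[OF oW s(1)] by blast
qed

end

context presheaf_with_filter
begin

text \<open>The \<open>m\<close> witnesses are chosen one after the other, outermost quantifier first.\<close>

lemma filter_witnesses:
  assumes max: "maximal_filter X F" and exact: "exact_presheaf X P"
  shows "wf_fm L (n + m) \<phi> \<Longrightarrow> U \<in> F \<Longrightarrow> a \<in> tuples (sec P U) n \<Longrightarrow>
    force_open X P ((Exists ^^ m) \<phi>) U a \<Longrightarrow>
    \<exists>V\<in>F. V \<subseteq> U \<and> (\<exists>b\<in>tuples (sec P V) m. force_open X P \<phi> V (restr P V U a @ b))"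
proof (induction m arbitrary: n U a)
  case 0
  then show ?case
    using restr_id[OF mem_open[OF 0(2)] 0(3)] by (intro bexI[of _ U]) (auto simp: tuples_def)
next
  case (Suc m)
  have oU: "openin X U" using Suc.prems(2) by (rule mem_open)
  have wf: "wf_fm L (Suc n) ((Exists ^^ m) \<phi>)"
  proof -
    have "wf_fm L (k + m) \<phi> \<Longrightarrow> wf_fm L k ((Exists ^^ m) \<phi>)" for k
      by (induction m arbitrary: k) auto
    then show ?thesis using Suc.prems(1) by simp
  qed
  obtain W s where W: "openin X W" "W \<subseteq> U" and s: "s \<in> carrier (sec P W)"
    and f: "force_open X P ((Exists ^^ m) \<phi>) W (restr P W U a @ [s])"
    and dense: "\<And>D. openin X D \<Longrightarrow> D \<subseteq> U \<Longrightarrow> D \<noteq> {} \<Longrightarrow> D \<inter> W \<noteq> {}"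
    using dense_witness[OF exact wf oU Suc.prems(3)] Suc.prems(4) by auto
  have "D \<inter> W \<noteq> {}" if "D \<in> F" for D
  proof -
    have "D \<inter> U \<in> F" using that Suc.prems(2) by (rule mem_Int)
    then show ?thesis using dense[of "D \<inter> U"] mem_open mem_nonempty by blast
  qed
  then have WF: "W \<in> F" using maximal_filter_memI[OF max W(1)] by blast
  have "restr P W U a @ [s] \<in> tuples (sec P W) (Suc n)"
    using restr_closed[OF presheaf Suc.prems(3) oU W] s by (auto simp: tuples_def)
  moreover have "wf_fm L (Suc n + m) \<phi>" using Suc.prems(1) by simp
  ultimately obtain V b where V: "V \<in> F" "V \<subseteq> W" and b: "b \<in> tuples (sec P V) m"
    and fV: "force_open X P \<phi> V (restr P V W (restr P W U a @ [s]) @ b)"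
    using Suc.IH[OF _ WF _ f] by blast
  have "restr P V W (restr P W U a @ [s]) @ b = restr P V U a @ (res P V W s # b)"
    using restr_trans[OF presheaf Suc.prems(3) oU W(1) mem_open[OF V(1)] V(2) W(2)] by simp
  moreover have "res P V W s # b \<in> tuples (sec P V) (Suc m)"
    using b res_closed[OF W(1) mem_open[OF V(1)] V(2) s] by (auto simp: tuples_def)
  ultimately show ?case using fV V W(2) by (metis subset_trans)
qed

lemma generic_if_maximal:
  assumes "maximal_filter X F" "exact_presheaf X P"
  shows "generic_filter X L P F"
  unfolding generic_filter_def
proof (rule conjI; intro allI impI ballI)
  fix n \<phi> U a assume "wf_fm L n \<phi>" "U \<in> F" "a \<in> tuples (sec P U) n"
  then show "\<exists>V\<in>F. V \<subseteq> U \<and>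
      (force_open X P \<phi> V (restr P V U a) \<or> force_open X P (Neg \<phi>) V (restr P V U a))"
    by (rule filter_decides[OF assms(1)])
next
  fix n m \<phi> U a
  assume "wf_fm L (n + m) \<phi>" "U \<in> F" "a \<in> tuples (sec P U) n"
    "force_open X P ((Exists ^^ m) \<phi>) U a"
  then show "\<exists>V\<in>F. V \<subseteq> U \<and> (\<exists>b\<in>tuples (sec P V) m. force_open X P \<phi> V (restr P V U a @ b))"
    by (rule filter_witnesses[OF assms])
qed


section \<open>The colimit over a filter is a G-structure\<close>

lemma germ_rel_iff:
  "((U, a), (V, b)) \<in> germ_rel P F \<longleftrightarrow>
    U \<in> F \<and> a \<in> carrier (sec P U) \<and> V \<in> F \<and> b \<in> carrier (sec P V) \<and>
    (\<exists>W\<in>F. W \<subseteq> U \<inter> V \<and> res P W U a = res P W V b)"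
  by (simp only: germ_rel_def mem_Collect_eq prod.inject) blast

lemma equiv_germ_rel: "equiv (SIGMA U:F. carrier (sec P U)) (germ_rel P F)"
proof (rule equivI)
  show "germ_rel P F \<subseteq> (SIGMA U:F. carrier (sec P U)) \<times> (SIGMA U:F. carrier (sec P U))"
    by (auto simp: germ_rel_iff)
  show "refl_on (SIGMA U:F. carrier (sec P U)) (germ_rel P F)"
    unfolding refl_on_def by (auto simp: germ_rel_iff)
  show "sym (germ_rel P F)"
  proof (rule symI, clarify)
    fix U a V b assume "((U, a), (V, b)) \<in> germ_rel P F"
    then show "((V, b), (U, a)) \<in> germ_rel P F" unfolding germ_rel_iff by (metis Int_commute)
  qed
  show "trans (germ_rel P F)"
  proof (rule transI, clarify)
    fix U a V b W c
    assume "((U, a), (V, b)) \<in> germ_rel P F" "((V, b), (W, c)) \<in> germ_rel P F"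
    then obtain A B where m: "U \<in> F" "V \<in> F" "W \<in> F" "A \<in> F" "B \<in> F"
      and c: "a \<in> carrier (sec P U)" "b \<in> carrier (sec P V)" "c \<in> carrier (sec P W)"
      and A: "A \<subseteq> U \<inter> V" "res P A U a = res P A V b"
      and B: "B \<subseteq> V \<inter> W" "res P B V b = res P B W c"
      unfolding germ_rel_iff by blast
    let ?D = "A \<inter> B"
    have D: "?D \<in> F" using m by (intro mem_Int)
    note o = mem_open[OF m(1)] mem_open[OF m(2)] mem_open[OF m(3)] mem_open[OF m(4)]
      mem_open[OF m(5)] mem_open[OF D]
    have "res P ?D U a = res P ?D A (res P A U a)"
      using res_trans[OF o(1,4,6) _ _ c(1)] A by auto
    also have "\<dots> = res P ?D V b" using res_trans[OF o(2,4,6) _ _ c(2)] A by auto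
    also have "\<dots> = res P ?D B (res P B V b)" using res_trans[OF o(2,5,6) _ _ c(2)] B by auto
    also have "\<dots> = res P ?D W c" using res_trans[OF o(3,5,6) _ _ c(3)] B by auto
    finally have "res P ?D U a = res P ?D W c" .
    moreover have "?D \<subseteq> U \<inter> W" using A B by blast
    ultimately show "((U, a), (W, c)) \<in> germ_rel P F"
      using m c D unfolding germ_rel_iff by blast
  qed
qed

lemma germ_eq_iff:
  assumes "U \<in> F" "a \<in> carrier (sec P U)" "V \<in> F" "b \<in> carrier (sec P V)"
  shows "germ P F U a = germ P F V b \<longleftrightarrow> (\<exists>W\<in>F. W \<subseteq> U \<inter> V \<and> res P W U a = res P W V b)"
proof -
  have "germ P F U a = germ P F V b \<longleftrightarrow> ((U, a), (V, b)) \<in> germ_rel P F"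
    using eq_equiv_class_iff[OF equiv_germ_rel, of "(U, a)" "(V, b)"] assms
    by (simp add: germ_def)
  then show ?thesis using assms by (simp add: germ_rel_iff)
qed

lemma germ_res:
  assumes "U \<in> F" "V \<in> F" "V \<subseteq> U" "a \<in> carrier (sec P U)"
  shows "germ P F V (res P V U a) = germ P F U a"
proof -
  have o: "openin X U" "openin X V" using assms mem_open by auto
  have "res P V U a \<in> carrier (sec P V)" using res_closed[OF o assms(3,4)] .
  then show ?thesis
    using germ_eq_iff[of V "res P V U a" U a] res_id[OF o(2)] assms by blast
qed

lemma germ_in_germs: "U \<in> F \<Longrightarrow> a \<in> carrier (sec P U) \<Longrightarrow> germ P F U a \<in> germs P F"
  unfolding germ_def germs_def by (intro quotientI) auto

lemma germs_cases:
  assumes "\<gamma> \<in> germs P F"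
  obtains U a where "U \<in> F" "a \<in> carrier (sec P U)" "\<gamma> = germ P F U a"
  using assms unfolding germs_def germ_def by (auto elim!: quotientE)

lemma map_germ_restr:
  assumes "U \<in> F" "V \<in> F" "V \<subseteq> U" "set as \<subseteq> carrier (sec P U)"
  shows "map (germ P F V) (restr P V U as) = map (germ P F U) as"
  using assms germ_res by auto

lemma common_representatives:
  "set \<gamma>s \<subseteq> germs P F \<Longrightarrow> \<exists>W\<in>F. \<exists>as. set as \<subseteq> carrier (sec P W) \<and> \<gamma>s = map (germ P F W) as"
proof (induction \<gamma>s)
  case Nil
  then show ?case using open_filterD(1)[OF filt] by auto
next
  case (Cons \<gamma> \<gamma>s)
  then obtain W as where W: "W \<in> F" "set as \<subseteq> carrier (sec P W)" "\<gamma>s = map (germ P F W) as"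
    by auto
  obtain U a where U: "U \<in> F" "a \<in> carrier (sec P U)" "\<gamma> = germ P F U a"
    using Cons.prems by (auto elim: germs_cases)
  let ?V = "U \<inter> W"
  have V: "?V \<in> F" using U W by (intro mem_Int)
  have "\<gamma> # \<gamma>s = map (germ P F ?V) (res P ?V U a # restr P ?V W as)"
    using germ_res[OF U(1) V _ U(2)] map_germ_restr[OF W(1) V _ W(2)] U(3) W(3)
    by (simp del: map_map)
  moreover have "set (res P ?V U a # restr P ?V W as) \<subseteq> carrier (sec P ?V)"
    using res_closed mem_open U W V by auto
  ultimately show ?case using V by (intro bexI[of _ ?V] exI conjI)
qed

lemma map_germ_eq:
  "U \<in> F \<Longrightarrow> V \<in> F \<Longrightarrow> set as \<subseteq> carrier (sec P U) \<Longrightarrow> set bs \<subseteq> carrier (sec P V) \<Longrightarrow>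
    map (germ P F U) as = map (germ P F V) bs \<Longrightarrow>
    \<exists>W\<in>F. W \<subseteq> U \<inter> V \<and> restr P W U as = restr P W V bs"
proof (induction as arbitrary: bs)
  case Nil
  then show ?case using mem_Int by auto
next
  case (Cons a as)
  then obtain b bs' where bs: "bs = b # bs'" by (cases bs) auto
  have "set as \<subseteq> carrier (sec P U)" "set bs' \<subseteq> carrier (sec P V)"
    "map (germ P F U) as = map (germ P F V) bs'"
    using Cons.prems(3-5) bs by auto
  then obtain W where W: "W \<in> F" "W \<subseteq> U \<inter> V" "restr P W U as = restr P W V bs'"
    using Cons.IH[OF Cons.prems(1,2)] by blast
  obtain W' where W': "W' \<in> F" "W' \<subseteq> U \<inter> V" "res P W' U a = res P W' V b"
    using germ_eq_iff[of U a V b] Cons.prems bs by auto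
  let ?D = "W \<inter> W'"
  have D: "?D \<in> F" using W W' by (intro mem_Int)
  note o = mem_open[OF Cons.prems(1)] mem_open[OF Cons.prems(2)] mem_open[OF W(1)]
    mem_open[OF W'(1)] mem_open[OF D]
  have "res P ?D U a = res P ?D W' (res P W' U a)"
    using res_trans[OF o(1,4,5), of a] W' Cons.prems by auto
  also have "\<dots> = res P ?D V b"
    using res_trans[OF o(2,4,5), of b] W' Cons.prems bs by auto
  finally have 1: "res P ?D U a = res P ?D V b" .
  have "restr P ?D U as = restr P ?D W (restr P W U as)"
    using restr_trans[OF presheaf _ o(1,3,5), of as "length as"] W Cons.prems
    by (auto simp: tuples_def)
  also have "\<dots> = restr P ?D W (restr P W V bs')" by (simp only: W(3))
  also have "\<dots> = restr P ?D V bs'"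
    using restr_trans[OF presheaf _ o(2,3,5), of bs' "length bs'"] W Cons.prems bs
    by (auto simp: tuples_def)
  finally have "restr P ?D U (a # as) = restr P ?D V bs" using 1 by (simp only: bs list.map)
  moreover have "?D \<subseteq> U \<inter> V" using W(2) by blast
  ultimately show ?case using D by (intro bexI[of _ ?D] conjI)
qed

lemma sec_gstruct: "U \<in> F \<Longrightarrow> is_gstruct G L (sec P U)"
  using presheaf mem_open by (auto simp: gstruct_presheaf_def)

lemma sec_lstruct: "U \<in> F \<Longrightarrow> is_lstruct L (sec P U)"
  using sec_gstruct by (auto simp: is_gstruct_def)

lemma sec_action: "U \<in> F \<Longrightarrow> group_action G (carrier (sec P U)) (act (sec P U))"
  using sec_gstruct by (auto simp: is_gstruct_def)

lemma act_closed:
  "U \<in> F \<Longrightarrow> g \<in> carrier G \<Longrightarrow> a \<in> carrier (sec P U) \<Longrightarrow> act (sec P U) g a \<in> carrier (sec P U)"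
  using group_action.element_image[OF sec_action] by blast

lemma fun_closed:
  "U \<in> F \<Longrightarrow> f \<in> fun_syms L \<Longrightarrow> as \<in> tuples (sec P U) (fun_arity L f) \<Longrightarrow>
    fun_int (sec P U) f as \<in> carrier (sec P U)"
  using sec_lstruct by (auto simp: is_lstruct_def)

lemma const_closed: "U \<in> F \<Longrightarrow> c \<in> const_syms L \<Longrightarrow> const_int (sec P U) c \<in> carrier (sec P U)"
  using sec_lstruct by (auto simp: is_lstruct_def)

lemma res_morphism:
  "U \<in> F \<Longrightarrow> V \<in> F \<Longrightarrow> V \<subseteq> U \<Longrightarrow> gstruct_morphism G L (sec P U) (sec P V) (res P V U)"
  using presheaf_morphism(2)[OF presheaf] mem_open by blast

text \<open>The next three lemmas say that taking germs at \<open>W\<close> commutes with the operations, which is to say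
  that the definite descriptions in the colimit do not depend on representatives.\<close>

lemma colim_fun:
  assumes f: "f \<in> fun_syms L" and W: "W \<in> F" and as: "as \<in> tuples (sec P W) (fun_arity L f)"
  shows "fun_int (colim_struct P F) f (map (germ P F W) as) = germ P F W (fun_int (sec P W) f as)"
proof -
  have indep: "germ P F V (fun_int (sec P V) f bs) = germ P F W (fun_int (sec P W) f as)"
    if V: "V \<in> F" and bs: "set bs \<subseteq> carrier (sec P V)"
      and eq: "map (germ P F W) as = map (germ P F V) bs" for V bs
  proof -
    have len: "length as = length bs" using eq by (metis length_map)
    have bs': "bs \<in> tuples (sec P V) (fun_arity L f)" using bs as len by (auto simp: tuples_def)
    obtain D where D: "D \<in> F" "D \<subseteq> W \<inter> V" and r: "restr P D W as = restr P D V bs"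
      using map_germ_eq[OF W V _ bs eq] as by (auto simp: tuples_def)
    have "res P D V (fun_int (sec P V) f bs) = fun_int (sec P D) f (restr P D V bs)"
      using res_morphism[OF V D(1)] D f bs' by (auto simp: gstruct_morphism_def)
    moreover have "res P D W (fun_int (sec P W) f as) = fun_int (sec P D) f (restr P D W as)"
      using res_morphism[OF W D(1)] D f as by (auto simp: gstruct_morphism_def)
    ultimately have
      "res P D V (fun_int (sec P V) f bs) = res P D W (fun_int (sec P W) f as)"
      using r by (simp only:)
    then show ?thesis
      using germ_eq_iff[OF V fun_closed[OF V f bs'] W fun_closed[OF W f as]] D by blast
  qed
  have "set as \<subseteq> carrier (sec P W)" using as by (simp add: tuples_def)
  then have "(THE \<delta>. \<exists>V\<in>F. \<exists>bs. set bs \<subseteq> carrier (sec P V) \<and>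
        map (germ P F W) as = map (germ P F V) bs \<and> \<delta> = germ P F V (fun_int (sec P V) f bs))
      = germ P F W (fun_int (sec P W) f as)"
    using W indep by (intro the_equality) blast+
  then show ?thesis by (simp add: colim_struct_def)
qed

lemma colim_const:
  assumes c: "c \<in> const_syms L" and W: "W \<in> F"
  shows "const_int (colim_struct P F) c = germ P F W (const_int (sec P W) c)"
proof -
  have indep: "germ P F V (const_int (sec P V) c) = germ P F W (const_int (sec P W) c)"
    if V: "V \<in> F" for V
  proof -
    have D: "V \<inter> W \<in> F" using V W by (rule mem_Int)
    have "res P (V \<inter> W) V (const_int (sec P V) c) = res P (V \<inter> W) W (const_int (sec P W) c)"
      using res_morphism[OF V D] res_morphism[OF W D] c by (auto simp: gstruct_morphism_def)
    then show ?thesis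
      using germ_eq_iff[OF V const_closed[OF V c] W const_closed[OF W c]] D by blast
  qed
  have "(THE \<delta>. \<exists>V\<in>F. \<delta> = germ P F V (const_int (sec P V) c))
      = germ P F W (const_int (sec P W) c)"
    using W indep by (intro the_equality) blast+
  then show ?thesis by (simp add: colim_struct_def)
qed

lemma colim_act:
  assumes g: "g \<in> carrier G" and W: "W \<in> F" and a: "a \<in> carrier (sec P W)"
  shows "act (colim_struct P F) g (germ P F W a) = germ P F W (act (sec P W) g a)"
proof -
  have indep: "germ P F V (act (sec P V) g b) = germ P F W (act (sec P W) g a)"
    if V: "V \<in> F" and b: "b \<in> carrier (sec P V)" and eq: "germ P F W a = germ P F V b" for V b
  proof -
    obtain D where D: "D \<in> F" "D \<subseteq> W \<inter> V" and r: "res P D W a = res P D V b"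
      using germ_eq_iff[OF W a V b] eq by blast
    have "res P D V (act (sec P V) g b) = res P D W (act (sec P W) g a)"
      using res_morphism[OF V D(1)] res_morphism[OF W D(1)] D g a b r
      by (auto simp: gstruct_morphism_def)
    then show ?thesis
      using germ_eq_iff[OF V act_closed[OF V g b] W act_closed[OF W g a]] D by blast
  qed
  have "(THE \<delta>. \<exists>V\<in>F. \<exists>b\<in>carrier (sec P V). germ P F W a = germ P F V b \<and>
        \<delta> = germ P F V (act (sec P V) g b)) = germ P F W (act (sec P W) g a)"
    using W a indep by (intro the_equality) blast+
  then show ?thesis using germ_in_germs[OF W a] by (simp add: colim_struct_def)
qed

lemma colim_carrier: "carrier (colim_struct P F) = germs P F"
  by (simp add: colim_struct_def)

lemma colim_tuplesE:
  assumes "\<gamma>s \<in> tuples (colim_struct P F) n"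
  obtains W as where "W \<in> F" "as \<in> tuples (sec P W) n" "\<gamma>s = map (germ P F W) as"
proof -
  have len: "length \<gamma>s = n" and "set \<gamma>s \<subseteq> germs P F"
    using assms by (auto simp: tuples_def colim_carrier)
  then obtain W as where W: "W \<in> F" "set as \<subseteq> carrier (sec P W)" "\<gamma>s = map (germ P F W) as"
    using common_representatives by blast
  then have "as \<in> tuples (sec P W) n" using len by (simp add: tuples_def)
  then show ?thesis using that W by blast
qed

lemma colim_rel_iff:
  "\<gamma>s \<in> rel_int (colim_struct P F) R \<longleftrightarrow>
    (\<exists>W\<in>F. \<exists>as\<in>rel_int (sec P W) R. \<gamma>s = map (germ P F W) as)"
  by (simp add: colim_struct_def)

lemma colim_lstruct: "is_lstruct L (colim_struct P F)"
  unfolding is_lstruct_def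
proof (intro conjI ballI)
  fix f \<gamma>s
  assume f: "f \<in> fun_syms L" and \<gamma>s: "\<gamma>s \<in> tuples (colim_struct P F) (fun_arity L f)"
  obtain W as where W: "W \<in> F" "as \<in> tuples (sec P W) (fun_arity L f)"
    and eq: "\<gamma>s = map (germ P F W) as" by (rule colim_tuplesE[OF \<gamma>s])
  show "fun_int (colim_struct P F) f \<gamma>s \<in> carrier (colim_struct P F)"
    using germ_in_germs[OF W(1) fun_closed[OF W(1) f W(2)]]
    by (simp only: eq colim_fun[OF f W] colim_carrier)
next
  fix R assume R: "R \<in> rel_syms L"
  show "rel_int (colim_struct P F) R \<subseteq> tuples (colim_struct P F) (rel_arity L R)"
  proof
    fix \<gamma>s assume "\<gamma>s \<in> rel_int (colim_struct P F) R"
    then obtain W as where W: "W \<in> F" "as \<in> rel_int (sec P W) R" "\<gamma>s = map (germ P F W) as"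
      by (auto simp: colim_rel_iff)
    then have "as \<in> tuples (sec P W) (rel_arity L R)"
      using sec_lstruct[OF W(1)] R by (auto simp: is_lstruct_def)
    then show "\<gamma>s \<in> tuples (colim_struct P F) (rel_arity L R)"
      using W germ_in_germs by (auto simp: tuples_def colim_carrier)
  qed
next
  fix c assume c: "c \<in> const_syms L"
  obtain W where W: "W \<in> F" using open_filterD(1)[OF filt] by blast
  show "const_int (colim_struct P F) c \<in> carrier (colim_struct P F)"
    using germ_in_germs[OF W const_closed[OF W c]]
    by (simp only: colim_const[OF c W] colim_carrier)
qed

lemma colim_group_action:
  assumes "group G"
  shows "group_action G (germs P F) (act (colim_struct P F))"
proof -
  interpret group G by fact
  let ?act = "act (colim_struct P F)"
  have closed: "?act g \<gamma> \<in> germs P F" if g: "g \<in> carrier G" and \<gamma>: "\<gamma> \<in> germs P F" for g \<gamma>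
    using \<gamma> by (rule germs_cases) (use g in \<open>auto simp: colim_act act_closed germ_in_germs\<close>)
  have one: "?act \<one>\<^bsub>G\<^esub> \<gamma> = \<gamma>" if "\<gamma> \<in> germs P F" for \<gamma>
    using that
  proof (rule germs_cases)
    fix U a assume U: "U \<in> F" "a \<in> carrier (sec P U)" "\<gamma> = germ P F U a"
    have "act (sec P U) \<one>\<^bsub>G\<^esub> a = a"
      using group_action.id_eq_one[OF sec_action[OF U(1)]] U(2) by (metis restrict_apply')
    then show ?thesis using U by (simp add: colim_act)
  qed
  have mult: "?act (g \<otimes>\<^bsub>G\<^esub> h) \<gamma> = ?act g (?act h \<gamma>)"
    if gh: "g \<in> carrier G" "h \<in> carrier G" and "\<gamma> \<in> germs P F" for g h \<gamma>
    using that(3)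
  proof (rule germs_cases)
    fix U a assume U: "U \<in> F" "a \<in> carrier (sec P U)" "\<gamma> = germ P F U a"
    then show ?thesis
      using gh group_action.composition_rule[OF sec_action[OF U(1)] U(2)]
      by (simp add: colim_act act_closed)
  qed
  have ext: "?act g \<in> extensional (germs P F)" for g
    by (simp add: colim_struct_def)
  have Bij: "?act g \<in> Bij (germs P F)" if g: "g \<in> carrier G" for g
  proof -
    have "bij_betw (?act g) (germs P F) (germs P F)"
    proof (rule bij_betw_byWitness[where f' = "?act (inv\<^bsub>G\<^esub> g)"])
      show "\<forall>\<gamma>\<in>germs P F. ?act (inv\<^bsub>G\<^esub> g) (?act g \<gamma>) = \<gamma>"
        using g mult[of "inv\<^bsub>G\<^esub> g" g] one by simp
      show "\<forall>\<gamma>\<in>germs P F. ?act g (?act (inv\<^bsub>G\<^esub> g) \<gamma>) = \<gamma>"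
        using g mult[of g "inv\<^bsub>G\<^esub> g"] one by simp
    qed (use g closed in auto)
    then show ?thesis using ext by (simp add: Bij_def)
  qed
  have "?act (g \<otimes>\<^bsub>G\<^esub> h) = compose (germs P F) (?act g) (?act h)"
    if "g \<in> carrier G" "h \<in> carrier G" for g h
    using mult[OF that] ext by (intro extensionalityI[of _ "germs P F"]) (auto simp: compose_def)
  then have "?act \<in> hom G (BijGroup (germs P F))"
    using Bij by (auto simp: hom_def BijGroup_def)
  then show ?thesis
    unfolding group_action_def group_hom_def group_hom_axioms_def
    using assms group_BijGroup by blast
qed

lemma colim_gstruct:
  assumes "group G"
  shows "is_gstruct G L (colim_struct P F)"
  unfolding is_gstruct_def
proof (intro conjI ballI allI impI)
  show "is_lstruct L (colim_struct P F)" by (rule colim_lstruct)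
  show "group_action G (carrier (colim_struct P F)) (act (colim_struct P F))"
    using colim_group_action[OF assms] by (simp add: colim_carrier)
next
  let ?M = "colim_struct P F"
  obtain W where W: "W \<in> F" using open_filterD(1)[OF filt] by blast
  \<comment> \<open>All constants are germs over this single \<open>W\<close>, and there the constants are invariant.\<close>
  have image: "const_int ?M ` const_syms L = germ P F W ` const_int (sec P W) ` const_syms L"
    using colim_const[OF _ W] by (auto simp: image_image)
  have "(\<Union>g\<in>carrier G. act ?M g ` (const_int ?M ` const_syms L)) =
      germ P F W ` (\<Union>g\<in>carrier G. act (sec P W) g ` const_int (sec P W) ` const_syms L)"
    unfolding image using colim_act[OF _ W] const_closed[OF W]
    by (simp add: image_image image_UN)
  also have "(\<Union>g\<in>carrier G. act (sec P W) g ` const_int (sec P W) ` const_syms L) =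
      const_int (sec P W) ` const_syms L"
    using sec_gstruct[OF W] by (simp add: is_gstruct_def)
  finally show "(\<Union>g\<in>carrier G. act ?M g ` (const_int ?M ` const_syms L)) =
      const_int ?M ` const_syms L"
    by (simp only: image)
next
  fix R \<gamma>s gs
  assume R: "R \<in> rel_syms L" and "\<gamma>s \<in> rel_int (colim_struct P F) R"
    and gs: "length gs = rel_arity L R \<and> set gs \<subseteq> carrier G"
  then obtain W as where W: "W \<in> F" and as: "as \<in> rel_int (sec P W) R"
    and eq: "\<gamma>s = map (germ P F W) as" by (auto simp: colim_rel_iff)
  have "as \<in> tuples (sec P W) (rel_arity L R)"
    using sec_lstruct[OF W] R as by (auto simp: is_lstruct_def)
  then have "set as \<subseteq> carrier (sec P W)" by (simp add: tuples_def)
  then have "act (colim_struct P F) g (germ P F W a) = germ P F W (act (sec P W) g a)"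
    if "(g, a) \<in> set (zip gs as)" for g a
    using set_zip_leftD[OF that] set_zip_rightD[OF that] gs by (intro colim_act[OF _ W]) auto
  then have "map2 (act (colim_struct P F)) gs \<gamma>s = map (germ P F W) (map2 (act (sec P W)) gs as)"
    unfolding eq zip_map2 map_map by (intro map_cong refl) auto
  moreover have "map2 (act (sec P W)) gs as \<in> rel_int (sec P W) R"
    using sec_gstruct[OF W] R as gs by (auto simp: is_gstruct_def)
  ultimately show "map2 (act (colim_struct P F)) gs \<gamma>s \<in> rel_int (colim_struct P F) R"
    using W unfolding colim_rel_iff by blast
next
  fix f \<gamma>s g
  assume f: "f \<in> fun_syms L" and \<gamma>s: "\<gamma>s \<in> tuples (colim_struct P F) (fun_arity L f)"
    and g: "g \<in> carrier G"
  obtain W as where W: "W \<in> F" and as: "as \<in> tuples (sec P W) (fun_arity L f)"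
    and eq: "\<gamma>s = map (germ P F W) as" by (rule colim_tuplesE[OF \<gamma>s])
  have gas: "map (act (sec P W) g) as \<in> tuples (sec P W) (fun_arity L f)"
    using as act_closed[OF W g] by (auto simp: tuples_def)
  have "map (act (colim_struct P F) g) \<gamma>s = map (germ P F W) (map (act (sec P W) g) as)"
    using as colim_act[OF g W] by (auto simp: eq tuples_def)
  then have "fun_int (colim_struct P F) f (map (act (colim_struct P F) g) \<gamma>s) =
      germ P F W (fun_int (sec P W) f (map (act (sec P W) g) as))"
    by (simp only: colim_fun[OF f W gas])
  also have "fun_int (sec P W) f (map (act (sec P W) g) as) = act (sec P W) g (fun_int (sec P W) f as)"
    using sec_gstruct[OF W] f as g by (simp add: is_gstruct_def)
  also have "germ P F W \<dots> = act (colim_struct P F) g (fun_int (colim_struct P F) f \<gamma>s)"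
    by (simp only: eq colim_fun[OF f W as] colim_act[OF g W fun_closed[OF W f as]])
  finally show "fun_int (colim_struct P F) f (map (act (colim_struct P F) g) \<gamma>s) =
      act (colim_struct P F) g (fun_int (colim_struct P F) f \<gamma>s)" .
qed

end


section \<open>Existence of generic G-models\<close>

theorem corollary4p2p1:
  fixes G :: "('g, 'k) monoid_scheme"
    and L :: "('f, 'r, 'c) lang"
    and X :: "'x topology"
    and P :: "('x, 'g, 'f, 'r, 'c, 's) presheaf"
  assumes "group G"
    and "topspace X \<noteq> {}"
    and "gstruct_presheaf G L X P"
    and "exact_presheaf X P"
  shows "\<exists>F. open_filter X F \<and> generic_filter X L P F \<and> is_gstruct G L (colim_struct P F)"
proof -
  obtain F where F: "maximal_filter X F" using maximal_filter_exists[OF assms(2)] by blast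
  then have filt: "open_filter X F" by (simp add: maximal_filter_def)
  interpret presheaf_with_filter G L X P F
    by unfold_locales (fact assms(3), fact filt)
  show ?thesis using filt generic_if_maximal[OF F assms(4)] colim_gstruct[OF assms(1)] by blast
qed

end
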